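(* Let $T$ be polynomial in $n$ and let $\hat\rho=(\hat\rho_1,\ldots,\hat\rho_T)$ be a $d$-delayed prediction for the subgraph connectivity problem. There is an algorithm solving the subgraph connectivity problem given $\hat\rho$ (without being given $d$) with polynomial preprocessing time $P(n)$, update time $U(n)=\tilde O(1)$ and query time $Q(n)=O(d^2)$.
   Context: Subgraph connectivity: a fixed $n$-vertex graph $G$ and an initial vertex subset $S_0\subseteq V$ are given; each update inserts a vertex into or removes a vertex from the current set $S$; each query asks, for a pair of vertices $u,v$, whether $u$ and $v$ are connected in the induced subgraph $G[S]$. Requests arrive online and queries must be answered before the next request. A permutation $\pi$ of $[T]$ acts by $\pi(\rho)=(\rho_{\pi(1)},\ldots,\rho_{\pi(T)})$ and is $d$-close to the identity if $|\pi^{-1}(t)-t|\le d$ for all $t$; $\hat\rho$ is $d$-delayed for the actual request sequence $\rho$ if $\pi(\rho)=\hat\rho$ for some such $\pi$. $\tilde O$ hides polylogarithmic factors. *)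

theory Defs
  imports
    Complex_Main
    "HOL-Library.Landau_Symbols"
    "HOL-Combinatorics.Permutations"
    "Graph_Theory.Graph_Theory"
begin

section \<open>A word RAM\<close>

text \<open>
  Algorithms are programs for a unit-cost word RAM, written in a structured language. A machine
  state consists of registers and of a memory; both hold words of \<open>w\<close> bits, represented as natural
  numbers below \<open>2 ^ w\<close>. Subtraction is truncated at \<open>0\<close>; every other result is reduced modulo
  \<open>2 ^ w\<close>. As addresses are computed words, only the first \<open>2 ^ w\<close> memory cells are accessible.
  Programs are finite objects that do not depend on the input or on the word length.
\<close>

datatype binop = Plus | Minus | Times | Div | Mod | Less | Equal

fun apply_op :: "binop \<Rightarrow> nat \<Rightarrow> nat \<Rightarrow> nat" where
  "apply_op Plus a b = a + b"
| "apply_op Minus a b = a - b"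
| "apply_op Times a b = a * b"
| "apply_op Div a b = a div b"
| "apply_op Mod a b = a mod b"
| "apply_op Less a b = (if a < b then 1 else 0)"
| "apply_op Equal a b = (if a = b then 1 else 0)"

datatype exp = Const nat | Reg nat | Mem exp | Op binop exp exp

datatype com =
    Skip
  | Assign nat exp
  | Store exp exp \<comment> \<open>address, value\<close>
  | Seq com com
  | If exp com com
  | While exp com

record state =
  regs :: "nat \<Rightarrow> nat"
  mem :: "nat \<Rightarrow> nat"

fun eval :: "nat \<Rightarrow> exp \<Rightarrow> state \<Rightarrow> nat" where
  "eval w (Const k) s = k mod 2 ^ w"
| "eval w (Reg r) s = regs s r"
| "eval w (Mem e) s = mem s (eval w e s)"
| "eval w (Op f e1 e2) s = apply_op f (eval w e1 s) (eval w e2 s) mod 2 ^ w"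

fun exp_time :: "exp \<Rightarrow> nat" where
  "exp_time (Const k) = 1"
| "exp_time (Reg r) = 1"
| "exp_time (Mem e) = exp_time e + 1"
| "exp_time (Op f e1 e2) = exp_time e1 + exp_time e2 + 1"

text \<open>\<open>exec w c s t s'\<close>: started in \<open>s\<close>, program \<open>c\<close> terminates in \<open>s'\<close> after \<open>t\<close> time units.\<close>

inductive exec :: "nat \<Rightarrow> com \<Rightarrow> state \<Rightarrow> nat \<Rightarrow> state \<Rightarrow> bool" for w :: nat where
  Skip: "exec w Skip s 1 s"
| Assign: "exec w (Assign r e) s (exp_time e + 1) (s\<lparr>regs := (regs s)(r := eval w e s)\<rparr>)"
| Store: "exec w (Store a e) s (exp_time a + exp_time e + 1)
            (s\<lparr>mem := (mem s)(eval w a s := eval w e s)\<rparr>)"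
| Seq: "exec w c1 s t1 s' \<Longrightarrow> exec w c2 s' t2 s'' \<Longrightarrow> exec w (Seq c1 c2) s (t1 + t2) s''"
| IfTrue: "eval w b s \<noteq> 0 \<Longrightarrow> exec w c1 s t s' \<Longrightarrow> exec w (If b c1 c2) s (exp_time b + 1 + t) s'"
| IfFalse: "eval w b s = 0 \<Longrightarrow> exec w c2 s t s' \<Longrightarrow> exec w (If b c1 c2) s (exp_time b + 1 + t) s'"
| WhileFalse: "eval w b s = 0 \<Longrightarrow> exec w (While b c) s (exp_time b + 1) s"
| WhileTrue: "eval w b s \<noteq> 0 \<Longrightarrow> exec w c s t1 s' \<Longrightarrow> exec w (While b c) s' t2 s'' \<Longrightarrow>
              exec w (While b c) s (exp_time b + 1 + t1 + t2) s''"

section \<open>Subgraph connectivity\<close>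

datatype request = Insert nat | Remove nat | Query nat nat

text \<open>
  The vertices are \<open>0, \<dots>, n - 1\<close>. Updates are proper: a vertex is inserted only if it is absent from
  the current set \<open>S\<close>, and removed only if it is present.
\<close>

fun valid_requests :: "nat \<Rightarrow> nat set \<Rightarrow> request list \<Rightarrow> bool" where
  "valid_requests n S [] \<longleftrightarrow> True"
| "valid_requests n S (Insert v # rs) \<longleftrightarrow> v < n \<and> v \<notin> S \<and> valid_requests n (insert v S) rs"
| "valid_requests n S (Remove v # rs) \<longleftrightarrow> v < n \<and> v \<in> S \<and> valid_requests n (S - {v}) rs"
| "valid_requests n S (Query u v # rs) \<longleftrightarrow> u < n \<and> v < n \<and> valid_requests n S rs"

text \<open>A simple undirected graph is a finite symmetric loop-free digraph without parallel arcs.\<close>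

definition graph_on :: "nat \<Rightarrow> nat pair_pre_digraph \<Rightarrow> bool" where
  "graph_on n G \<longleftrightarrow> pair_graph G \<and> pverts G = {..<n}"

text \<open>This is false if \<open>u\<close> or \<open>v\<close> is not in \<open>S\<close>.\<close>

definition connected_in :: "nat pair_pre_digraph \<Rightarrow> nat set \<Rightarrow> nat \<Rightarrow> nat \<Rightarrow> bool" where
  "connected_in G S u v \<longleftrightarrow> u \<rightarrow>\<^sup>*\<^bsub>with_proj G \<restriction> S\<^esub> v"

section \<open>Delayed predictions\<close>

text \<open>
  Positions are numbered from \<open>0\<close>. The list \<open>permute_list \<pi> \<rho>\<close> has the entry \<open>\<rho> ! \<pi> t\<close> at position \<open>t\<close>.
\<close>

definition close_to_id :: "nat \<Rightarrow> nat \<Rightarrow> (nat \<Rightarrow> nat) \<Rightarrow> bool" where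
  "close_to_id T d \<pi> \<longleftrightarrow> \<pi> permutes {..<T} \<and> (\<forall>t<T. \<bar>int (inv \<pi> t) - int t\<bar> \<le> int d)"

definition delayed :: "nat \<Rightarrow> 'a list \<Rightarrow> 'a list \<Rightarrow> bool" where
  "delayed d \<rho> \<rho>' \<longleftrightarrow> (\<exists>\<pi>. close_to_id (length \<rho>) d \<pi> \<and> permute_list \<pi> \<rho> = \<rho>')"

section \<open>Dynamic algorithms with predictions\<close>

record dyn_alg =
  prep :: com
  on_insert :: com
  on_remove :: com
  on_query :: com

fun encode_request :: "request \<Rightarrow> nat list" where
  "encode_request (Insert v) = [0, v, 0]"
| "encode_request (Remove v) = [1, v, 0]"
| "encode_request (Query u v) = [2, u, v]"

text \<open>
  Initially, registers \<open>0\<close> and \<open>1\<close> hold the number of vertices and the number of predicted requests.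
  The memory starts with the adjacency matrix (row by row), the characteristic vector of the initial
  set and the predicted requests (three words each). All other registers and cells are \<open>0\<close>.
\<close>

definition input_words :: "nat \<Rightarrow> nat pair_pre_digraph \<Rightarrow> nat set \<Rightarrow> request list \<Rightarrow> nat list" where
  "input_words n G S\<^sub>0 \<rho>' =
     concat (map (\<lambda>u. map (\<lambda>v. if (u, v) \<in> parcs G then 1 else 0) [0..<n]) [0..<n])
     @ map (\<lambda>v. if v \<in> S\<^sub>0 then 1 else 0) [0..<n]
     @ concat (map encode_request \<rho>')"

definition init_state ::
  "nat \<Rightarrow> nat \<Rightarrow> nat pair_pre_digraph \<Rightarrow> nat set \<Rightarrow> request list \<Rightarrow> state" where
  "init_state w n G S\<^sub>0 \<rho>' =
     \<lparr>regs = (\<lambda>r. if r = 0 then n mod 2 ^ w else if r = 1 then length \<rho>' mod 2 ^ w else 0),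
      mem = (\<lambda>a. let xs = input_words n G S\<^sub>0 \<rho>' in if a < length xs then xs ! a mod 2 ^ w else 0)\<rparr>"

text \<open>
  The arguments of a request are passed in registers \<open>0\<close> and \<open>1\<close>; the answer to a query (\<open>1\<close> for yes,
  \<open>0\<close> for no) is expected in register \<open>0\<close>. The remaining registers and the memory persist.
\<close>

definition pass1 :: "nat \<Rightarrow> nat \<Rightarrow> state \<Rightarrow> state" where
  "pass1 w u s = s\<lparr>regs := (regs s)(0 := u mod 2 ^ w)\<rparr>"

definition pass2 :: "nat \<Rightarrow> nat \<Rightarrow> nat \<Rightarrow> state \<Rightarrow> state" where
  "pass2 w u v s = s\<lparr>regs := (regs s)(0 := u mod 2 ^ w, 1 := v mod 2 ^ w)\<rparr>"

text \<open>
  \<open>serves w A G U Q S s \<rho>\<close>: with current vertex set \<open>S\<close> and machine state \<open>s\<close>, algorithm \<open>A\<close> handles the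
  requests \<open>\<rho>\<close> one after the other, spends at most \<open>U\<close> time units on each update and at most \<open>Q\<close>
  time units on each query, and answers every query correctly before it sees the next request.
\<close>

fun serves :: "nat \<Rightarrow> dyn_alg \<Rightarrow> nat pair_pre_digraph \<Rightarrow> nat \<Rightarrow> nat \<Rightarrow>
    nat set \<Rightarrow> state \<Rightarrow> request list \<Rightarrow> bool" where
  "serves w A G U Q S s [] \<longleftrightarrow> True"
| "serves w A G U Q S s (Insert v # \<rho>) \<longleftrightarrow>
     (\<exists>t s'. exec w (on_insert A) (pass1 w v s) t s' \<and> t \<le> U \<and>
        serves w A G U Q (insert v S) s' \<rho>)"
| "serves w A G U Q S s (Remove v # \<rho>) \<longleftrightarrow>
     (\<exists>t s'. exec w (on_remove A) (pass1 w v s) t s' \<and> t \<le> U \<and>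
        serves w A G U Q (S - {v}) s' \<rho>)"
| "serves w A G U Q S s (Query u v # \<rho>) \<longleftrightarrow>
     (\<exists>t s'. exec w (on_query A) (pass2 w u v s) t s' \<and> t \<le> Q \<and>
        regs s' 0 = (if connected_in G S u v then 1 else 0) \<and>
        serves w A G U Q S s' \<rho>)"

definition solves :: "nat \<Rightarrow> dyn_alg \<Rightarrow> nat \<Rightarrow> nat pair_pre_digraph \<Rightarrow> nat set \<Rightarrow>
    request list \<Rightarrow> request list \<Rightarrow> nat \<Rightarrow> nat \<Rightarrow> nat \<Rightarrow> bool" where
  "solves w A n G S\<^sub>0 \<rho>' \<rho> P U Q \<longleftrightarrow>
     (\<exists>t s. exec w (prep A) (init_state w n G S\<^sub>0 \<rho>') t s \<and> t \<le> P \<and> serves w A G U Q S\<^sub>0 s \<rho>)"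

definition poly_bounded :: "(nat \<Rightarrow> nat) \<Rightarrow> bool" where
  "poly_bounded f \<longleftrightarrow> (\<exists>k::nat. (\<lambda>n. real (f n)) \<in> O(\<lambda>n. real n ^ k))"

definition polylog_bounded :: "(nat \<Rightarrow> nat) \<Rightarrow> bool" where
  "polylog_bounded f \<longleftrightarrow> (\<exists>k::nat. (\<lambda>n. real (f n)) \<in> O(\<lambda>n. ln (real n) ^ k))"

end

(*
  Read every update as a toggle of its vertex. Let ps t be the vertex set after the first t predicted
  requests, let touched t k consist of the vertices of the updates at the predicted positions in
  [t - k, t + k), and let core t k = ps t - touched t k. If the prediction is d-delayed, a vertex
  outside touched t d has been toggled equally often by the first t actual and the first t predicted
  requests. So the actual set S differs from ps t only inside touched t d, which has at most 2d
  elements.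

  Preprocessing tabulates for all t, k, x, y whether a path leads from x to y with all interior
  vertices in core t k (Warshall's algorithm). Updates maintain S, its symmetric difference with ps t
  and the size of this difference. A query enlarges k until touched t k covers the difference, which
  happens for some k \<le> d although d is unknown. Then core t k \<subseteq> S, and S exceeds core t k by O(d)
  vertices; a graph search on these vertices and the two query vertices, with adjacency read off the
  table, takes O(d^2) time.
*)

theory Submission
  imports Defs
begin

section \<open>Reasoning about programs\<close>

text \<open>The obstacle is that the query time may depend on \<open>d\<close> alone: a query can
  neither clear an array of length \<open>n\<close>, nor list the difference between actual and
  predicted set, nor recompute connectivity. As \<open>T\<close> is polynomial in \<open>n\<close>,
  the (T + 1)^2 * n^2 entries are affordable. The table restricts only the interior of a path, not
  its endpoints. A single entry can therefore be used between any two vertices that a query adds to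
  the core. Toggles matter because the parity of the updates of a vertex depends only on how often
  it occurs among the requests so far, so that comparing the two sequences becomes counting under a
  permutation. A reordered sequence can also insert a present vertex or remove an absent one. The
  word length enters only through the demand that every address and intermediate value fits into one
  word.\<close>

definition wp :: "nat \<Rightarrow> com \<Rightarrow> nat \<Rightarrow> (state \<Rightarrow> bool) \<Rightarrow> state \<Rightarrow> bool" where
  "wp w c t Q s \<longleftrightarrow> (\<exists>t' s'. exec w c s t' s' \<and> t' \<le> t \<and> Q s')"

lemma wp_conseq:
  assumes "wp w c t Q s" "\<And>s'. Q s' \<Longrightarrow> Q' s'" "t \<le> t'"
  shows "wp w c t' Q' s"
  using assms unfolding wp_def by (meson order_trans)

lemma wp_Seq:
  assumes "wp w c1 t1 (wp w c2 t2 Q) s" "t1 + t2 \<le> t"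
  shows "wp w (Seq c1 c2) t Q s"
proof -
  obtain u1 s1 u2 s2 where "exec w c1 s u1 s1" "u1 \<le> t1" "exec w c2 s1 u2 s2" "u2 \<le> t2" "Q s2"
    using assms(1) unfolding wp_def by blast
  then show ?thesis
    using assms(2) unfolding wp_def by (meson add_mono exec.Seq order_trans)
qed

lemma wp_If:
  assumes "eval w b s \<noteq> 0 \<Longrightarrow> wp w c1 t Q s" "eval w b s = 0 \<Longrightarrow> wp w c2 t Q s"
    and "exp_time b + 1 + t \<le> t'"
  shows "wp w (If b c1 c2) t' Q s"
proof (cases "eval w b s = 0")
  case True
  then obtain u s1 where u: "exec w c2 s u s1" "u \<le> t" "Q s1"
    using assms(2) unfolding wp_def by blast
  show ?thesis
    using assms(3) u exec.IfFalse[OF True u(1)] unfolding wp_def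
    by (intro exI[of _ "exp_time b + 1 + u"] exI[of _ s1]) auto
next
  case False
  then obtain u s1 where u: "exec w c1 s u s1" "u \<le> t" "Q s1"
    using assms(1) unfolding wp_def by blast
  show ?thesis
    using assms(3) u exec.IfTrue[OF False u(1)] unfolding wp_def
    by (intro exI[of _ "exp_time b + 1 + u"] exI[of _ s1]) auto
qed

text \<open>The measure bounds the number of iterations; the \<open>+ 1\<close> pays for the final
  failing test.\<close>

lemma wp_While:
  assumes inv: "I s"
    and body: "\<And>s. I s \<Longrightarrow> eval w b s \<noteq> 0 \<Longrightarrow> wp w c tb (\<lambda>s'. I s' \<and> \<mu> s' < \<mu> s) s"
    and post: "\<And>s. I s \<Longrightarrow> eval w b s = 0 \<Longrightarrow> Q s"
    and time: "(\<mu> s + 1) * (tb + exp_time b + 1) \<le> t"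
  shows "wp w (While b c) t Q s"
proof -
  have "\<exists>t' s'. exec w (While b c) s t' s' \<and> t' \<le> (\<mu> s + 1) * (tb + exp_time b + 1) \<and> Q s'"
    using inv
  proof (induction "\<mu> s" arbitrary: s rule: less_induct)
    case less
    show ?case
    proof (cases "eval w b s = 0")
      case True
      then show ?thesis
        using post[OF less.prems] exec.WhileFalse[OF True]
        by (intro exI[of _ "exp_time b + 1"] exI[of _ s]) auto
    next
      case False
      then obtain u s1 where s1: "exec w c s u s1" "u \<le> tb" "I s1" "\<mu> s1 < \<mu> s"
        using body[OF less.prems] unfolding wp_def by blast
      then obtain u' s2 where s2: "exec w (While b c) s1 u' s2"
          "u' \<le> (\<mu> s1 + 1) * (tb + exp_time b + 1)" "Q s2"
        using less.hyps by blast
      have "(\<mu> s1 + 1) * (tb + exp_time b + 1) \<le> \<mu> s * (tb + exp_time b + 1)"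
        using s1(4) by (intro mult_right_mono) auto
      then have "exp_time b + 1 + u + u' \<le> (\<mu> s + 1) * (tb + exp_time b + 1)"
        using s1(2) s2(2) by (auto simp: add_mult_distrib)
      then show ?thesis
        using exec.WhileTrue[OF False s1(1) s2(1)] s2(3) by blast
    qed
  qed
  then show ?thesis
    using time unfolding wp_def by (meson order_trans)
qed

section \<open>Loop-free programs as functions on states\<close>

fun loopfree :: "com \<Rightarrow> bool" where
  "loopfree (Seq c1 c2) \<longleftrightarrow> loopfree c1 \<and> loopfree c2"
| "loopfree (If b c1 c2) \<longleftrightarrow> loopfree c1 \<and> loopfree c2"
| "loopfree (While b c) \<longleftrightarrow> False"
| "loopfree _ \<longleftrightarrow> True"

text \<open>Without loops the final state is computed by the simplifier instead of being derived
  rule by rule. The last equation also catches \<open>While\<close>, where its value is only a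
  placeholder; \<open>exec_step\<close> therefore demands \<open>loopfree\<close>.\<close>

fun step :: "nat \<Rightarrow> com \<Rightarrow> state \<Rightarrow> state" where
  "step w (Assign r e) s = s\<lparr>regs := (regs s)(r := eval w e s)\<rparr>"
| "step w (Store a e) s = s\<lparr>mem := (mem s)(eval w a s := eval w e s)\<rparr>"
| "step w (Seq c1 c2) s = step w c2 (step w c1 s)"
| "step w (If b c1 c2) s = (if eval w b s \<noteq> 0 then step w c1 s else step w c2 s)"
| "step w _ s = s"

fun ctime :: "com \<Rightarrow> nat" where
  "ctime (Assign r e) = exp_time e + 1"
| "ctime (Store a e) = exp_time a + exp_time e + 1"
| "ctime (Seq c1 c2) = ctime c1 + ctime c2"
| "ctime (If b c1 c2) = exp_time b + 1 + max (ctime c1) (ctime c2)"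
| "ctime _ = 1"

lemma exec_step: "loopfree c \<Longrightarrow> \<exists>t\<le>ctime c. exec w c s t (step w c s)"
proof (induction c arbitrary: s)
  case (Seq c1 c2)
  then obtain t1 t2 where "t1 \<le> ctime c1" "exec w c1 s t1 (step w c1 s)"
    "t2 \<le> ctime c2" "exec w c2 (step w c1 s) t2 (step w c2 (step w c1 s))"
    by (metis loopfree.simps(1))
  then show ?case
    by (auto intro!: exI[of _ "t1 + t2"] exec.Seq)
next
  case (If b c1 c2)
  obtain t1 t2 where t: "t1 \<le> ctime c1" "exec w c1 s t1 (step w c1 s)"
    "t2 \<le> ctime c2" "exec w c2 s t2 (step w c2 s)"
    using If.IH[of s] If.prems by auto
  show ?case
  proof (cases "eval w b s = 0")
    case True
    then show ?thesis
      using t exec.IfFalse[OF True t(4)]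
      by (intro exI[of _ "exp_time b + 1 + t2"]) auto
  next
    case False
    then show ?thesis
      using t exec.IfTrue[OF False t(2)]
      by (intro exI[of _ "exp_time b + 1 + t1"]) auto
  qed
qed (use exec.Skip exec.Assign exec.Store in \<open>auto 4 4\<close>)

lemma wp_step:
  assumes "loopfree c" "ctime c \<le> t" "Q (step w c s)"
  shows "wp w c t Q s"
  using exec_step[OF assms(1)] assms(2,3) unfolding wp_def by (meson order_trans)

lemma wp_stepI:
  assumes "loopfree c" "ctime c \<le> t" "step w c s = s'" "Q s'"
  shows "wp w c t Q s"
  using assms wp_step by blast

lemma wp_Seq_step:
  assumes "loopfree c1" "wp w c2 t2 Q (step w c1 s)" "ctime c1 + t2 \<le> t"
  shows "wp w (Seq c1 c2) t Q s"
  using assms by (blast intro: wp_Seq wp_step)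

lemma wp_Seq_conseq:
  assumes "wp w c1 t1 R s" "\<And>s'. R s' \<Longrightarrow> wp w c2 t2 Q s'" "t1 + t2 \<le> t"
  shows "wp w (Seq c1 c2) t Q s"
  using assms by (blast intro: wp_Seq wp_conseq)

fun block :: "com list \<Rightarrow> com" where
  "block [] = Skip"
| "block [c] = c"
| "block (c # cs) = Seq c (block cs)"

section \<open>Paths with restricted interior\<close>

text \<open>Only inner vertices are confined to \<open>A\<close>; both endpoints are free. The case
  \<open>refl\<close> makes the diagonal true, matching the table.\<close>

inductive via :: "('a \<Rightarrow> 'a \<Rightarrow> bool) \<Rightarrow> 'a set \<Rightarrow> 'a \<Rightarrow> 'a \<Rightarrow> bool" for E A x where
  refl: "via E A x x"
| edge: "E x y \<Longrightarrow> via E A x y"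
| extend: "via E A x z \<Longrightarrow> z \<in> A \<Longrightarrow> E z y \<Longrightarrow> via E A x y"

lemma via_mono: "via E A x y \<Longrightarrow> A \<subseteq> B \<Longrightarrow> via E B x y"
  by (induction rule: via.induct) (auto intro: via.intros)

lemma via_trans: "via E A z y \<Longrightarrow> z \<in> A \<Longrightarrow> via E A x z \<Longrightarrow> via E A x y"
  by (induction rule: via.induct) (auto intro: via.intros)

lemma via_empty: "via E {} x y \<longleftrightarrow> x = y \<or> E x y"
  by (auto intro: via.intros elim: via.cases)

text \<open>The recurrence of Warshall's algorithm. Whenever the path passes \<open>z\<close>, the
  second segment is restarted there, so repeated visits to \<open>z\<close> collapse into
  one.\<close>

lemma via_insertD: "via E (insert z A) x y \<Longrightarrow> via E A x y \<or> via E A x z \<and> via E A z y"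
  by (induction rule: via.induct) (auto intro: via.intros)

lemma via_insert: "via E (insert z A) x y \<longleftrightarrow> via E A x y \<or> via E A x z \<and> via E A z y"
  by (meson insertI1 subset_insertI via_insertD via_mono via_trans)

text \<open>Cutting a path of \<open>G[S]\<close> at its vertices in \<open>X\<close> gives pieces with interior in \<open>C\<close>.\<close>

lemma connected_in_iff_via:
  assumes S: "S = C \<union> X" and u: "u \<in> X" and v: "v \<in> X"
  shows "connected_in G S u v \<longleftrightarrow>
    (u, v) \<in> {(x, y). x \<in> X \<and> y \<in> X \<and> via (\<lambda>x y. (x, y) \<in> parcs G) C x y}\<^sup>*"
    (is "_ \<longleftrightarrow> (u, v) \<in> ?R\<^sup>*")
proof
  let ?E = "\<lambda>x y. (x, y) \<in> parcs G"
  let ?H = "with_proj G \<restriction> S"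
  have ends: "(x, y) \<in> arcs_ends ?H \<longleftrightarrow> x \<in> S \<and> y \<in> S \<and> ?E x y" for x y
    by (force simp: arcs_ends_def arc_to_ends_def)
  {
    assume "connected_in G S u v"
    then have "(u, v) \<in> rtrancl_on S (arcs_ends ?H)"
      unfolding connected_in_def reachable_def by simp
    \<comment> \<open>The invariant remembers the last cut point \<open>x\<close>. On meeting a
      vertex of \<open>X\<close>, that vertex becomes the new cut point; otherwise the piece from
      \<open>x\<close> grows by an inner vertex of \<open>C\<close>.\<close>
    then have "\<exists>x. (u, x) \<in> ?R\<^sup>* \<and> x \<in> X \<and> via ?E C x v"
    proof (induction rule: rtrancl_on_induct)
      case base
      then show ?case using u by (blast intro: via.refl)
    next
      case (step y z)
      then obtain x where x: "(u, x) \<in> ?R\<^sup>*" "x \<in> X" "via ?E C x y" by blast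
      have e: "?E y z" using step(2) ends by simp
      show ?case
      proof (cases "y \<in> X")
        case True
        then have "(u, y) \<in> ?R\<^sup>*" using x by (auto intro: rtrancl_into_rtrancl)
        then show ?thesis using True e by (blast intro: via.edge)
      next
        case False
        then have "y \<in> C" using step(3) S by blast
        then show ?thesis using x e by (blast intro: via.extend)
      qed
    qed
    then show "(u, v) \<in> ?R\<^sup>*"
      using v by (auto intro: rtrancl_into_rtrancl)
  }
  have sub: "(x, y) \<in> rtrancl_on S (arcs_ends ?H)" if "via ?E C x y" "x \<in> S" "y \<in> S" for x y
    using that(1,3)
  proof (induction rule: via.induct)
    case refl
    then show ?case by simp
  next
    case (edge y)
    then show ?case
      using that(2) ends by (metis rtrancl_on_into_rtrancl_on rtrancl_on_refl)
  next
    case (extend z y)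
    then show ?case
      using S ends by (metis UnCI rtrancl_on_into_rtrancl_on)
  qed
  assume "(u, v) \<in> ?R\<^sup>*"
  then have "(u, v) \<in> rtrancl_on S (arcs_ends ?H)"
  proof (induction rule: rtrancl_induct)
    case base
    then show ?case using u S by simp
  next
    case (step y z)
    then have "(y, z) \<in> rtrancl_on S (arcs_ends ?H)"
      using sub S by blast
    then show ?case using step by (meson rtrancl_on_trans)
  qed
  then show "connected_in G S u v"
    unfolding connected_in_def reachable_def by simp
qed

section \<open>The predicted vertex sets\<close>

fun targets :: "request \<Rightarrow> nat set" where
  "targets (Insert v) = {v}"
| "targets (Remove v) = {v}"
| "targets (Query u v) = {}"

definition hits :: "nat \<Rightarrow> request list \<Rightarrow> nat" where
  "hits v rs = length (filter (\<lambda>r. v \<in> targets r) rs)"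

text \<open>
  A predicted sequence need not consist of proper updates. Reading every update as a toggle gives the
  same sets for proper sequences, and makes the result independent of the order of the requests.
\<close>

definition set_after :: "nat set \<Rightarrow> request list \<Rightarrow> nat set" where
  "set_after S rs = {v. (v \<in> S) \<noteq> odd (hits v rs)}"

definition toggle :: "nat \<Rightarrow> nat set \<Rightarrow> nat set" where
  "toggle x D = {v. (v \<in> D) \<noteq> (v = x)}"

lemma set_after_Nil: "set_after S [] = S"
  by (simp add: set_after_def hits_def)

lemma set_after_snoc:
  "set_after S (rs @ [r]) = {v. (v \<in> set_after S rs) \<noteq> (v \<in> targets r)}"
  by (auto simp: set_after_def hits_def)

lemma hits_take:
  "t \<le> length rs \<Longrightarrow> hits v (take t rs) = card {i. i < t \<and> v \<in> targets (rs ! i)}"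
proof -
  assume t: "t \<le> length rs"
  have "hits v (take t rs) = card {i. i < length (take t rs) \<and> v \<in> targets (take t rs ! i)}"
    unfolding hits_def by (rule length_filter_conv_card)
  also have "{i. i < length (take t rs) \<and> v \<in> targets (take t rs ! i)} = {i. i < t \<and> v \<in> targets (rs ! i)}"
    using t by auto
  finally show ?thesis .
qed

definition touched :: "request list \<Rightarrow> nat \<Rightarrow> nat \<Rightarrow> nat set" where
  "touched rs t k = (\<Union>p \<in> {t - k..<t + k} \<inter> {..<length rs}. targets (rs ! p))"

lemma touched_0: "touched rs t 0 = {}"
  by (simp add: touched_def)

text \<open>The window gains one position at each end, which is how \<open>scan_body\<close> and
  \<open>shrink_core\<close> enlarge it. For \<open>t \<le> k\<close> its left end is already
  clipped at \<open>0\<close>.\<close>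

lemma touched_Suc:
  "touched rs t (Suc k) = touched rs t k \<union> (if k < t \<and> t - Suc k < length rs then targets (rs ! (t - Suc k)) else {})
     \<union> (if t + k < length rs then targets (rs ! (t + k)) else {})"
proof -
  have "{t - Suc k..<t + Suc k} \<inter> {..<length rs} = ({t - k..<t + k} \<inter> {..<length rs})
      \<union> ((if k < t then {t - Suc k} else {}) \<inter> {..<length rs}) \<union> ({t + k} \<inter> {..<length rs})"
    by auto
  then show ?thesis
    unfolding touched_def by auto
qed

lemma delayed_length: "delayed d rs rs' \<Longrightarrow> length rs' = length rs"
  unfolding delayed_def by auto

lemma delayed_set: "delayed d rs rs' \<Longrightarrow> set rs' = set rs"
  unfolding delayed_def close_to_id_def by auto

text \<open>No displacement exceeds the length of the sequence. This caps the radius at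
  \<open>T\<close>, the largest one tabulated.\<close>

lemma delayed_min_length: "delayed d rs rs' \<Longrightarrow> delayed (min d (length rs)) rs rs'"
proof -
  assume "delayed d rs rs'"
  then obtain \<pi> where p: "\<pi> permutes {..<length rs}" "permute_list \<pi> rs = rs'"
    "\<And>t. t < length rs \<Longrightarrow> \<bar>int (inv \<pi> t) - int t\<bar> \<le> int d"
    unfolding delayed_def close_to_id_def by blast
  have "\<bar>int (inv \<pi> t) - int t\<bar> \<le> int (min d (length rs))" if "t < length rs" for t
  proof -
    have "inv \<pi> t < length rs"
      using permutes_in_image[OF permutes_inv[OF p(1)], of t] that by simp
    then show ?thesis using p(3)[OF that] that by auto
  qed
  then show ?thesis
    using p(1,2) unfolding delayed_def close_to_id_def by blast
qed

text \<open>\<open>\<pi>\<close> maps the predicted positions of updates of \<open>v\<close> before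
  \<open>t\<close> bijectively onto the actual ones. Displacement by at most \<open>d\<close> could
  only move a position across \<open>t\<close> from inside the window, which contains no update of
  \<open>v\<close>.\<close>

lemma hits_take_delayed:
  assumes "delayed d rs rs'" "t \<le> length rs" "v \<notin> touched rs' t d"
  shows "hits v (take t rs) = hits v (take t rs')"
proof -
  obtain \<pi> where p: "\<pi> permutes {..<length rs}" "permute_list \<pi> rs = rs'"
    "\<And>t. t < length rs \<Longrightarrow> \<bar>int (inv \<pi> t) - int t\<bar> \<le> int d"
    using assms(1) unfolding delayed_def close_to_id_def by blast
  have len: "length rs' = length rs" using p(2) by auto
  have nth: "rs' ! i = rs ! \<pi> i" if "i < length rs" for i
    using p(1,2) that by (metis permute_list_nth)
  have dist: "\<bar>int i - int (\<pi> i)\<bar> \<le> int d" if "i < length rs" for i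
  proof -
    have "\<pi> i < length rs" using permutes_in_image[OF p(1), of i] that by simp
    then show ?thesis using p(3)[of "\<pi> i"] permutes_inverses(2)[OF p(1), of i] by simp
  qed
  \<comment> \<open>An update of \<open>v\<close> to the left of the window's right end cannot lie
    in the window, hence precedes it; a shift by \<open>d\<close> then stays before
    \<open>t\<close>.\<close>
  have far: "i < t - d" if "i < t + d" "i < length rs" "v \<in> targets (rs' ! i)" for i
    using that assms(3) len unfolding touched_def by (auto simp: not_le)
  let ?A = "{i. i < t \<and> v \<in> targets (rs' ! i)}"
  let ?B = "{i. i < t \<and> v \<in> targets (rs ! i)}"
  have image: "\<pi> ` ?A = ?B"
  proof (intro set_eqI iffI)
    fix j assume "j \<in> \<pi> ` ?A"
    then obtain i where i: "j = \<pi> i" "i < t" "v \<in> targets (rs' ! i)" by auto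
    then show "j \<in> ?B"
      using far[of i] dist[of i] nth[of i] assms(2) by auto
  next
    fix j assume j: "j \<in> ?B"
    define i where "i = inv \<pi> j"
    have i: "\<pi> i = j" unfolding i_def using permutes_inverses(1)[OF p(1)] by simp
    have il: "i < length rs"
      using permutes_in_image[OF p(1), of i] i j assms(2) by auto
    then have "v \<in> targets (rs' ! i)" "i < t + d"
      using nth[OF il] dist[OF il] i j by auto
    then have "i \<in> ?A" using far[of i] il by auto
    then show "j \<in> \<pi> ` ?A" using i by blast
  qed
  have "card ?B = card ?A"
    using card_image[OF permutes_inj_on[OF p(1)], of ?A] unfolding image .
  then show ?thesis
    using assms(2) len by (simp add: hits_take)
qed

section \<open>The programs\<close>

text \<open>
  The input occupies the cells below \<open>L\<close>. Behind it, several arrays are interleaved: cell \<open>i\<close> of array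
  \<open>r < 8\<close> has address \<open>L + 8 * i + r\<close>, so that no bounds are needed to keep them apart. They hold
  0: the current set, 1: its symmetric difference with the predicted set, 2: the time stamps of
  vertices seen by a query, 3: the predicted set, 4: the core (prediction without touched vertices),
  5: the nodes of the auxiliary graph of a query, 6: the table of connections through the cores.

  Registers 2 to 5 hold \<open>n\<close>, \<open>T\<close>, \<open>L\<close> and the address of the predicted requests; register 6 holds the
  current time and register 7 the size of the symmetric difference.
\<close>

definition adx :: "nat \<Rightarrow> exp \<Rightarrow> exp" where
  "adx r e = Op Plus (Reg 4) (Op Plus (Op Times (Const 8) e) (Const r))"

definition arr :: "nat \<Rightarrow> exp \<Rightarrow> exp" where
  "arr r e = Mem (adx r e)"

definition put :: "nat \<Rightarrow> exp \<Rightarrow> exp \<Rightarrow> com" where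
  "put r i e = Store (adx r i) e"

definition rq_type :: "exp \<Rightarrow> exp" where
  "rq_type e = Mem (Op Plus (Reg 5) (Op Times (Const 3) e))"

definition rq_vertex :: "exp \<Rightarrow> exp" where
  "rq_vertex e = Mem (Op Plus (Op Plus (Reg 5) (Op Times (Const 3) e)) (Const 1))"

definition incr :: "nat \<Rightarrow> com" where
  "incr r = Assign r (Op Plus (Reg r) (Const 1))"

definition toggle_diff :: com where
  "toggle_diff = If (arr 1 (Reg 14))
     (block [put 1 (Reg 14) (Const 0), Assign 7 (Op Minus (Reg 7) (Const 1))])
     (block [put 1 (Reg 14) (Const 1), incr 7])"

definition advance :: com where
  "advance = block [
     If (Op Less (rq_type (Reg 6)) (Const 2)) (block [Assign 14 (rq_vertex (Reg 6)), toggle_diff]) Skip,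
     incr 6]"

text \<open>One program serves both kinds of update, since a proper insertion or removal is a
  toggle.\<close>

definition update :: com where
  "update = block [
     put 0 (Reg 0) (Op Minus (Const 1) (arr 0 (Reg 0))), Assign 14 (Reg 0), toggle_diff, advance]"

text \<open>Register 9 counts the differing vertices met so far and register 10 the nodes collected
  in array 5. A vertex counts as seen if its stamp is the current time plus one, so older stamps,
  including the initial \<open>0\<close>, need no clearing.\<close>

definition touch :: com where
  "touch = If (Op Less (rq_type (Reg 13)) (Const 2))
     (block [Assign 14 (rq_vertex (Reg 13)),
        If (Op Equal (arr 2 (Reg 14)) (Op Plus (Reg 6) (Const 1))) Skip
          (block [put 2 (Reg 14) (Op Plus (Reg 6) (Const 1)),
             Assign 9 (Op Plus (Reg 9) (arr 1 (Reg 14))),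
             If (arr 0 (Reg 14)) (block [put 5 (Reg 10) (Reg 14), incr 10]) Skip])])
     Skip"

definition scan_body :: com where
  "scan_body = block [incr 8,
        If (Op Less (Reg 6) (Reg 8)) Skip (block [Assign 13 (Op Minus (Reg 6) (Reg 8)), touch]),
        If (Op Less (Reg 3) (Op Plus (Reg 6) (Reg 8))) Skip
          (block [Assign 13 (Op Minus (Op Plus (Reg 6) (Reg 8)) (Const 1)), touch])]"

text \<open>Register 7 holds the size of the whole difference, so equality of the two counters means
  that the window covers it.\<close>

definition scan :: com where
  "scan = While (Op Less (Reg 9) (Reg 7)) scan_body"

text \<open>The pair of time and radius is numbered \<open>t * (T + 1) + k\<close>; each such block
  has \<open>n * n\<close> cells.\<close>

definition block_start :: exp where
  "block_start = Op Times (Op Plus (Op Times (Reg 6) (Op Plus (Reg 3) (Const 1))) (Reg 8))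
     (Op Times (Reg 2) (Reg 2))"

text \<open>Array 5 is kept partitioned: nodes below register 11 are processed, those from there to
  register 12 are discovered but pending, the rest is undiscovered. Register 13 runs through the
  rest, and a neighbour is swapped to the end of the discovered prefix.\<close>

definition search_inner :: com where
  "search_inner = While (Op Less (Reg 13) (Reg 10)) (block [
     If (arr 6 (Op Plus (Reg 9) (Op Plus (Op Times (arr 5 (Reg 11)) (Reg 2)) (arr 5 (Reg 13)))))
       (block [Assign 14 (arr 5 (Reg 13)), put 5 (Reg 13) (arr 5 (Reg 12)), put 5 (Reg 12) (Reg 14), incr 12])
       Skip,
     incr 13])"

definition search :: com where
  "search = While (Op Less (Reg 11) (Reg 12)) (Seq (Assign 13 (Reg 12)) (Seq search_inner (incr 11)))"

definition lookup :: com where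
  "lookup = While (Op Less (Reg 11) (Reg 12)) (block [
     If (Op Equal (arr 5 (Reg 11)) (Reg 1)) (Assign 0 (Const 1)) Skip, incr 11])"

text \<open>The endpoints are placed first, \<open>u\<close> at position \<open>0\<close> where the
  search starts. They may be collected again by \<open>touch\<close>; duplicate nodes are harmless
  because only the set of entries matters.\<close>

definition query :: com where
  "query = Seq
     (If (Op Times (arr 0 (Reg 0)) (arr 0 (Reg 1)))
       (Seq (block [put 5 (Const 0) (Reg 0), put 5 (Const 1) (Reg 1), Assign 8 (Const 0),
               Assign 9 (Const 0), Assign 10 (Const 2)])
       (Seq scan
       (Seq (block [Assign 9 block_start, Assign 11 (Const 0), Assign 12 (Const 1)])
       (Seq search
       (Seq (block [Assign 0 (Const 0), Assign 11 (Const 0)])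
       lookup)))))
       (Assign 0 (Const 0)))
     advance"

definition copy_input :: com where
  "copy_input = While (Op Less (Reg 11) (Reg 2)) (block [
     put 0 (Reg 11) (Mem (Op Plus (Op Times (Reg 2) (Reg 2)) (Reg 11))),
     put 3 (Reg 11) (Mem (Op Plus (Op Times (Reg 2) (Reg 2)) (Reg 11))),
     incr 11])"

definition copy_pred :: com where
  "copy_pred = While (Op Less (Reg 11) (Reg 2)) (block [put 4 (Reg 11) (arr 3 (Reg 11)), incr 11])"

definition init_block :: com where
  "init_block = While (Op Less (Reg 11) (Op Times (Reg 2) (Reg 2))) (block [
     put 6 (Op Plus (Reg 9) (Reg 11)) (Mem (Reg 11)),
     If (Op Equal (Op Div (Reg 11) (Reg 2)) (Op Mod (Reg 11) (Reg 2)))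
       (put 6 (Op Plus (Reg 9) (Reg 11)) (Const 1)) Skip,
     incr 11])"

definition warshall_inner :: com where
  "warshall_inner = While (Op Less (Reg 11) (Op Times (Reg 2) (Reg 2))) (block [
     If (Op Times
          (arr 6 (Op Plus (Reg 9) (Op Plus (Op Times (Op Div (Reg 11) (Reg 2)) (Reg 2)) (Reg 10))))
          (arr 6 (Op Plus (Reg 9) (Op Plus (Op Times (Reg 10) (Reg 2)) (Op Mod (Reg 11) (Reg 2))))))
       (put 6 (Op Plus (Reg 9) (Reg 11)) (Const 1)) Skip,
     incr 11])"

definition warshall :: com where
  "warshall = While (Op Less (Reg 10) (Reg 2))
     (Seq (If (arr 4 (Reg 10)) (Seq (Assign 11 (Const 0)) warshall_inner) Skip) (incr 10))"

definition untouch :: com where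
  "untouch = If (Op Less (rq_type (Reg 13)) (Const 2)) (put 4 (rq_vertex (Reg 13)) (Const 0)) Skip"

definition shrink_core :: com where
  "shrink_core = block [incr 8,
     If (Op Less (Reg 6) (Reg 8)) Skip (block [Assign 13 (Op Minus (Reg 6) (Reg 8)), untouch]),
     If (Op Less (Reg 3) (Op Plus (Reg 6) (Reg 8))) Skip
       (block [Assign 13 (Op Minus (Op Plus (Reg 6) (Reg 8)) (Const 1)), untouch])]"

definition fill_time :: com where
  "fill_time = While (Op Less (Reg 8) (Op Plus (Reg 3) (Const 1)))
     (Seq (block [Assign 9 block_start, Assign 11 (Const 0)])
     (Seq init_block
     (Seq (Assign 10 (Const 0))
     (Seq warshall
     shrink_core))))"

definition advance_pred :: com where
  "advance_pred = block [
     If (Op Less (Reg 6) (Reg 3))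
       (If (Op Less (rq_type (Reg 6)) (Const 2))
         (put 3 (rq_vertex (Reg 6)) (Op Minus (Const 1) (arr 3 (rq_vertex (Reg 6))))) Skip)
       Skip,
     incr 6]"

definition fill_table :: com where
  "fill_table = While (Op Less (Reg 6) (Op Plus (Reg 3) (Const 1)))
     (Seq (Assign 11 (Const 0))
     (Seq copy_pred
     (Seq (Assign 8 (Const 0))
     (Seq fill_time
     advance_pred))))"

definition preprocess :: com where
  "preprocess =
     Seq (block [Assign 2 (Reg 0), Assign 3 (Reg 1),
       Assign 5 (Op Plus (Op Times (Reg 2) (Reg 2)) (Reg 2)),
       Assign 4 (Op Plus (Reg 5) (Op Times (Const 3) (Reg 3)))])
     (Seq copy_input
     (Seq fill_table
     (Assign 6 (Const 0))))"

definition algorithm :: dyn_alg where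
  "algorithm = \<lparr>prep = preprocess, on_insert = update, on_remove = update, on_query = query\<rparr>"

definition block_time :: "nat \<Rightarrow> nat" where
  "block_time n = 200 * (n * n + 1) + (n + 1) * (200 * (n * n + 1) + 100) + 300"

definition step_time :: "nat \<Rightarrow> nat \<Rightarrow> nat" where
  "step_time n T = 100 * (n + 1) + (T + 2) * (block_time n + 10) + 200"

definition prep_time :: "nat \<Rightarrow> nat \<Rightarrow> nat" where
  "prep_time n T = 100 * (n + 1) + (T + 2) * (step_time n T + 10) + 100"

lemmas code_defs = adx_def arr_def put_def rq_type_def rq_vertex_def incr_def toggle_diff_def
  advance_def update_def touch_def scan_body_def block_start_def untouch_def shrink_core_def advance_pred_def

text \<open>
  Under the word size assumption no operation overflows; the conditional rewrite rules of the locale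
  below replace the defining equations, which reduce modulo \<open>2 ^ w\<close>.
\<close>

declare eval.simps(1,4)[simp del]

definition adr :: "nat \<Rightarrow> nat \<Rightarrow> nat \<Rightarrow> nat" where
  "adr L r i = L + 8 * i + r"

definition ar :: "nat \<Rightarrow> (nat \<Rightarrow> nat) \<Rightarrow> nat \<Rightarrow> nat \<Rightarrow> nat" where
  "ar L m r i = m (adr L r i)"

lemma ar_upd [simp]:
  assumes "r < 8" "r' < 8"
  shows "ar L (m(adr L r i := x)) r' = (if r' = r then (ar L m r)(i := x) else ar L m r')"
proof -
  have "adr L r' j = adr L r i \<longleftrightarrow> r' = r \<and> j = i" for j
  proof
    assume "adr L r' j = adr L r i"
    then have eq: "8 * j + r' = 8 * i + r" by (simp add: adr_def)
    then have "(8 * j + r') div 8 = (8 * i + r) div 8" by simp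
    then have "j = i" using assms by simp
    then show "r' = r \<and> j = i" using eq by simp
  qed simp
  then show ?thesis by (auto simp: ar_def fun_eq_iff)
qed

section \<open>Correctness and running time\<close>

text \<open>\<open>M\<close> exceeds every array index: table cells, vertices and at most
  \<open>2 * T + 2\<close> node positions. By \<open>fits\<close>, the addresses
  \<open>L + 8 * i + r\<close> with \<open>i < M\<close> are words. The \<open>+ 1\<close> next to
  \<open>n * n\<close> keeps block numbers below \<open>M\<close> even for
  \<open>n = 0\<close>.\<close>

locale subgraph_instance =
  fixes w n T W L M :: nat and G :: "nat pair_pre_digraph" and S0 :: "nat set" and rs :: "request list"
  assumes W: "W = 2 ^ w"
    and L: "L = n * n + n + 3 * T"
    and M: "M = (T + 1) * (T + 1) * (n * n + 1) + n + 2 * T + 8"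
    and fits: "L + 8 * M + 8 \<le> W"
    and len: "length rs = T"
    and S0: "S0 \<subseteq> {..<n}"
    and vertices: "\<And>r. r \<in> set rs \<Longrightarrow> targets r \<subseteq> {..<n}"
begin

abbreviation "AR s \<equiv> ar L (mem s)"
abbreviation "nn \<equiv> n * n"

definition ty :: "nat \<Rightarrow> nat" where "ty p = encode_request (rs ! p) ! 0"
definition vx :: "nat \<Rightarrow> nat" where "vx p = encode_request (rs ! p) ! 1"

lemma targets_nth: "targets (rs ! p) = (if ty p < 2 then {vx p} else {})"
  by (cases "rs ! p") (auto simp: ty_def vx_def)

lemma vx_less: "p < T \<Longrightarrow> ty p < 2 \<Longrightarrow> vx p < n"
  using vertices[of "rs ! p"] len by (auto simp: targets_nth)

definition okr :: "(nat \<Rightarrow> nat) \<Rightarrow> bool" where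
  "okr f \<longleftrightarrow> f 2 = n \<and> f 3 = T \<and> f 4 = L \<and> f 5 = nn + n"

definition okm :: "(nat \<Rightarrow> nat) \<Rightarrow> bool" where
  "okm m \<longleftrightarrow> (\<forall>i<nn. m i = of_bool ((i div n, i mod n) \<in> parcs G)) \<and>
     (\<forall>v<n. m (nn + v) = of_bool (v \<in> S0)) \<and>
     (\<forall>p<T. m (nn + n + 3 * p) = ty p \<and> m (nn + n + 3 * p + 1) = vx p)"

lemma okr_upd [simp]: "r \<notin> {2,3,4,5} \<Longrightarrow> okr (f(r := x)) = okr f"
  by (auto simp: okr_def)

lemma okr_simps [simp]: "okr f \<Longrightarrow> f 2 = n" "okr f \<Longrightarrow> f 3 = T" "okr f \<Longrightarrow> f 4 = L" "okr f \<Longrightarrow> f 5 = nn + n"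
  by (auto simp: okr_def)

text \<open>All arrays lie behind the input, so no \<open>put\<close> can damage it.\<close>

lemma okm_upd [simp]: "okm (m(adr L r i := x)) = okm m"
  unfolding okm_def adr_def L by auto

lemma bounds: "n + 8 \<le> M" "2 * T + 8 \<le> M" "8 * M + 8 + L \<le> W" "nn + n + 3 * T \<le> L" "nn + 8 \<le> M"
  "M < W" "L < W"
  using fits by (auto simp: M L)

lemma ev_Const [simp]: "k \<le> 8 \<Longrightarrow> eval w (Const k) s = k"
proof -
  assume "k \<le> 8"
  then have "k < W" using bounds(2,6) by linarith
  then show ?thesis using W by (simp add: eval.simps(1))
qed

lemma ev_Plus [simp]: "eval w a s + eval w b s < W \<Longrightarrow> eval w (Op Plus a b) s = eval w a s + eval w b s"
  using W by (simp add: eval.simps(4))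

lemma ev_Minus [simp]: "eval w a s - eval w b s < W \<Longrightarrow> eval w (Op Minus a b) s = eval w a s - eval w b s"
  using W by (simp add: eval.simps(4))

lemma ev_Times [simp]: "eval w a s * eval w b s < W \<Longrightarrow> eval w (Op Times a b) s = eval w a s * eval w b s"
  using W by (simp add: eval.simps(4))

lemma ev_Div [simp]: "eval w a s div eval w b s < W \<Longrightarrow> eval w (Op Div a b) s = eval w a s div eval w b s"
  using W by (simp add: eval.simps(4))

lemma ev_Mod [simp]: "eval w a s mod eval w b s < W \<Longrightarrow> eval w (Op Mod a b) s = eval w a s mod eval w b s"
  using W by (simp add: eval.simps(4))

lemma ev_Less [simp]: "eval w (Op Less a b) s = of_bool (eval w a s < eval w b s)"
  using bounds(3) W by (simp add: eval.simps(4))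

lemma ev_Equal [simp]: "eval w (Op Equal a b) s = of_bool (eval w a s = eval w b s)"
  using bounds(3) W by (simp add: eval.simps(4))

lemma ev_adx [simp]:
  "okr (regs s) \<Longrightarrow> r < 8 \<Longrightarrow> eval w e s < M \<Longrightarrow> eval w (adx r e) s = adr L r (eval w e s)"
  using bounds(3) by (simp add: adx_def adr_def)

lemma ev_arr [simp]:
  "okr (regs s) \<Longrightarrow> r < 8 \<Longrightarrow> eval w e s < M \<Longrightarrow> eval w (arr r e) s = AR s r (eval w e s)"
  by (simp add: arr_def ar_def)

lemma ev_rq [simp]:
  assumes "okr (regs s)" "okm (mem s)" "eval w e s < T"
  shows "eval w (rq_type e) s = ty (eval w e s)" "eval w (rq_vertex e) s = vx (eval w e s)"
  using assms bounds by (auto simp: rq_type_def rq_vertex_def okm_def)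

lemma step_put [simp]:
  "okr (regs s) \<Longrightarrow> r < 8 \<Longrightarrow> eval w i s < M \<Longrightarrow>
   step w (put r i e) s = s\<lparr>mem := (mem s)(adr L r (eval w i s) := eval w e s)\<rparr>"
  by (simp add: put_def)

lemma step_incr [simp]:
  "regs s r + 1 < W \<Longrightarrow> step w (incr r) s = s\<lparr>regs := (regs s)(r := regs s r + 1)\<rparr>"
  by (simp add: incr_def)

section \<open>Predicted sets, cores and the invariant between requests\<close>

definition ps :: "nat \<Rightarrow> nat set" where
  "ps t = set_after S0 (take t rs)"

lemma hits_eq_0: "\<not> v < n \<Longrightarrow> hits v (take t rs) = 0"
  using vertices unfolding hits_def by (auto simp: filter_empty_conv dest!: in_set_takeD)

lemma ps_subset: "ps t \<subseteq> {..<n}"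
  using S0 hits_eq_0[of _ t] by (fastforce simp: ps_def set_after_def)

lemma ps_0: "ps 0 = S0"
  by (simp add: ps_def set_after_Nil)

lemma ps_Suc: "t < T \<Longrightarrow> ps (Suc t) = (if ty t < 2 then toggle (vx t) (ps t) else ps t)"
  using len by (auto simp: ps_def take_Suc_conv_app_nth set_after_snoc targets_nth toggle_def)

definition core :: "nat \<Rightarrow> nat \<Rightarrow> nat set" where
  "core t k = ps t - touched rs t k"

abbreviation "E \<equiv> (\<lambda>x y. (x, y) \<in> parcs G)"

definition tab_ok :: "(nat \<Rightarrow> nat) \<Rightarrow> nat \<Rightarrow> bool" where
  "tab_ok f q \<longleftrightarrow> (\<forall>i<nn. f (q * nn + i) =
     of_bool (via E (core (q div (T + 1)) (q mod (T + 1))) (i div n) (i mod n)))"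

definition diff :: "nat \<Rightarrow> nat set \<Rightarrow> nat set" where
  "diff t S = {v. (v \<in> S) \<noteq> (v \<in> ps t)}"

text \<open>The parameter \<open>b\<close> bounds all time stamps. With \<open>b = t\<close> the
  stamp \<open>Suc t\<close> is fresh for a query at time \<open>t\<close>; after stamping,
  \<open>b = Suc t\<close> agrees with the advanced time again.\<close>

definition serving :: "nat \<Rightarrow> nat \<Rightarrow> nat set \<Rightarrow> state \<Rightarrow> bool" where
  "serving t b S s \<longleftrightarrow> okr (regs s) \<and> okm (mem s) \<and> regs s 6 = t \<and> S \<subseteq> {..<n} \<and>
     regs s 7 = card (diff t S) \<and>
     (\<forall>v<n. AR s 0 v = of_bool (v \<in> S)) \<and>
     (\<forall>v<n. AR s 1 v = of_bool (v \<in> diff t S)) \<and>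
     (\<forall>v<n. AR s 2 v \<le> b) \<and>
     (\<forall>q<(T + 1) * (T + 1). tab_ok (AR s 6) q)"

section \<open>Maintaining the symmetric difference\<close>

lemma card_le_n: "D \<subseteq> {..<n} \<Longrightarrow> card D \<le> n"
  using card_mono[of "{..<n}" D] by simp

lemma toggle_card:
  assumes "D \<subseteq> {..<n}"
  shows "x \<in> D \<Longrightarrow> card (toggle x D) = card D - 1" "x \<notin> D \<Longrightarrow> card (toggle x D) = card D + 1"
proof -
  have "finite D" using assms finite_subset by blast
  moreover have "x \<in> D \<Longrightarrow> toggle x D = D - {x}" "x \<notin> D \<Longrightarrow> toggle x D = insert x D"
    by (auto simp: toggle_def)
  ultimately show "x \<in> D \<Longrightarrow> card (toggle x D) = card D - 1" "x \<notin> D \<Longrightarrow> card (toggle x D) = card D + 1"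
    by auto
qed

lemma step_toggle_diff:
  assumes "okr (regs s)" "regs s 14 < n" "D \<subseteq> {..<n}"
    "\<forall>v<n. AR s 1 v = of_bool (v \<in> D)" "regs s 7 = card D"
  shows "regs (step w toggle_diff s) = (regs s)(7 := card (toggle (regs s 14) D))"
    "okm (mem (step w toggle_diff s)) = okm (mem s)"
    "\<And>r. r < 8 \<Longrightarrow> r \<noteq> 1 \<Longrightarrow> AR (step w toggle_diff s) r = AR s r"
    "\<And>v. v < n \<Longrightarrow> AR (step w toggle_diff s) 1 v = of_bool (v \<in> toggle (regs s 14) D)"
  using assms card_le_n[OF assms(3)] bounds(1,6) toggle_card[OF assms(3), of "regs s 14"]
  by (cases "regs s 14 \<in> D"; force simp: toggle_diff_def toggle_def)+

text \<open>Toggling a vertex in either of two sets toggles it in their symmetric difference. Thus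
  the same code handles the actual request and the predicted one.\<close>

lemma diff_Suc: "t < T \<Longrightarrow> diff (Suc t) S = (if ty t < 2 then toggle (vx t) (diff t S) else diff t S)"
  by (auto simp: diff_def ps_Suc toggle_def)

lemma diff_toggle: "diff t (toggle x S) = toggle x (diff t S)"
  by (auto simp: diff_def toggle_def)

lemma diff_subset: "S \<subseteq> {..<n} \<Longrightarrow> diff t S \<subseteq> {..<n}"
  using ps_subset[of t] by (auto simp: diff_def)

lemma serving_advance:
  assumes s: "serving t b S s" and t: "t < T"
  shows "serving (Suc t) b S (step w advance s)" "regs (step w advance s) 0 = regs s 0"
proof -
  note s' = s[unfolded serving_def]
  define s0 where "s0 = s\<lparr>regs := (regs s)(14 := vx t)\<rparr>"
  define s1 where "s1 = (if ty t < 2 then step w toggle_diff s0 else s)"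
  have r6: "regs s1 6 = t \<and> okr (regs s1) \<and> okm (mem s1) \<and> regs s1 0 = regs s 0 \<and>
      regs s1 7 = card (diff (Suc t) S) \<and> (\<forall>r<8. r \<noteq> 1 \<longrightarrow> AR s1 r = AR s r) \<and>
      (\<forall>v<n. AR s1 1 v = of_bool (v \<in> diff (Suc t) S))"
  proof (cases "ty t < 2")
    case True
    have "okr (regs s0)" "regs s0 14 < n" "\<forall>v<n. AR s0 1 v = of_bool (v \<in> diff t S)"
      "regs s0 7 = card (diff t S)" "diff t S \<subseteq> {..<n}"
      using s' vx_less[OF t True] diff_subset[of S t] by (auto simp: s0_def)
    note td = step_toggle_diff[OF this(1,2,5,3,4)]
    show ?thesis
      using True s' t td by (simp add: s1_def diff_Suc) (simp add: s0_def)
  next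
    case False
    then show ?thesis using s' t by (simp add: s1_def diff_Suc)
  qed
  have st: "step w advance s = s1\<lparr>regs := (regs s1)(6 := Suc t)\<rparr>"
    using s' t bounds(2,6) r6 by (auto simp: advance_def s1_def s0_def)
  show "serving (Suc t) b S (step w advance s)" "regs (step w advance s) 0 = regs s 0"
    using s' r6 unfolding st serving_def by auto
qed

lemma serving_update:
  assumes s: "serving t b S s" and t: "t < T" and v: "regs s 0 < n"
  shows "serving (Suc t) b (toggle (regs s 0) S) (step w update s)"
proof -
  let ?v = "regs s 0"
  note s' = s[unfolded serving_def]
  define s0 where "s0 = s\<lparr>mem := (mem s)(adr L 0 ?v := 1 - AR s 0 ?v), regs := (regs s)(14 := ?v)\<rparr>"
  define s1 where "s1 = step w toggle_diff s0"
  have eq: "step w update s = step w advance s1"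
    using s' v bounds(1,6) by (simp add: update_def s1_def s0_def)
  have "okr (regs s0)" "regs s0 14 < n" "\<forall>v<n. AR s0 1 v = of_bool (v \<in> diff t S)"
    "regs s0 7 = card (diff t S)" "diff t S \<subseteq> {..<n}"
    using s' v diff_subset[of S t] by (auto simp: s0_def)
  note td = step_toggle_diff[OF this(1,2,5,3,4), folded s1_def]
  have a0: "AR s1 0 x = of_bool (x \<in> toggle ?v S)" if "x < n" for x
    using td(3)[of 0] s' that by (auto simp: s0_def toggle_def)
  have a2: "AR s1 2 = AR s 2" "AR s1 6 = AR s 6"
    using td(3) by (auto simp: s0_def)
  have "toggle ?v S \<subseteq> {..<n}"
    using s' v by (auto simp: toggle_def)
  then have "serving t b (toggle ?v S) s1"
    unfolding serving_def diff_toggle using s' td(1,2,4) a0 a2 by (auto simp: s0_def)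
  then show ?thesis unfolding eq by (rule serving_advance(1)[OF _ t])
qed

subsection \<open>Queries\<close>

text \<open>\<open>D\<close> is the set of stamped vertices and \<open>p\<close> an upper bound for
  the number of nodes. The nodes are described by an image, which tolerates repeated
  endpoints.\<close>

definition scanned :: "nat \<Rightarrow> nat set \<Rightarrow> nat \<Rightarrow> nat \<Rightarrow> nat set \<Rightarrow> nat \<Rightarrow> state \<Rightarrow> bool" where
  "scanned t S u v D p s \<longleftrightarrow> serving t (Suc t) S s \<and> regs s 0 = u \<and> regs s 1 = v \<and>
     D \<subseteq> {..<n} \<and> regs s 9 = card (diff t S \<inter> D) \<and>
     regs s 10 \<le> p \<and> 0 < regs s 10 \<and> (\<forall>x<n. AR s 2 x = Suc t \<longleftrightarrow> x \<in> D) \<and> AR s 5 0 = u \<and>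
     AR s 5 ` {..<regs s 10} = {u, v} \<union> (S \<inter> D)"

lemma scanned_regs:
  assumes "scanned t S u v D p s" "r \<in> {8, 11, 12, 13, 14}"
  shows "scanned t S u v D p (s\<lparr>regs := (regs s)(r := x)\<rparr>)"
  using assms unfolding scanned_def serving_def by auto

lemma scanned_touch:
  assumes s: "scanned t S u v D p s" and pos: "regs s 13 < T" and p: "p + 2 < M" and t: "t < T"
  shows "scanned t S u v (D \<union> targets (rs ! regs s 13)) (Suc p) (step w touch s)"
    "regs (step w touch s) 8 = regs s 8"
proof -
  note s' = s[unfolded scanned_def serving_def]
  let ?x = "vx (regs s 13)"
  consider "\<not> ty (regs s 13) < 2" | "ty (regs s 13) < 2" "?x \<in> D" | "ty (regs s 13) < 2" "?x \<notin> D" by blast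
  then have "scanned t S u v (D \<union> targets (rs ! regs s 13)) (Suc p) (step w touch s) \<and>
    regs (step w touch s) 8 = regs s 8"
  proof cases
    case 1
    then have "step w touch s = s" using s' pos by (simp add: touch_def)
    then show ?thesis using s 1 by (simp add: targets_nth scanned_def)
  next
    case 2
    have st: "step w touch s = s\<lparr>regs := (regs s)(14 := ?x)\<rparr>"
      using s' pos 2 t bounds vx_less[OF pos 2(1)] by (simp add: touch_def)
    have "insert ?x D = D" using 2 by auto
    then show ?thesis
      using scanned_regs[OF s, of 14 ?x] 2 unfolding st targets_nth by (simp add: scanned_def)
  next
    case 3
    have x: "?x < n" by (rule vx_less[OF pos 3(1)])
    have dsub: "diff t S \<subseteq> {..<n}" by (rule diff_subset) (simp add: s')
    have fin: "finite (diff t S \<inter> D)" by (rule finite_subset[of _ "{..<n}"]) (use dsub in auto)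
    have cardle: "card (diff t S \<inter> D) \<le> n" by (rule card_le_n) (use dsub in auto)
    have c: "card (diff t S \<inter> insert ?x D) = card (diff t S \<inter> D) + of_bool (?x \<in> diff t S)"
      using fin 3 by auto
    define s1 where "s1 = s\<lparr>mem := (mem s)(adr L 2 ?x := Suc t), 
       regs := (regs s)(14 := ?x, 9 := card (diff t S \<inter> insert ?x D))\<rparr>"
    define s2 where "s2 = (if ?x \<in> S then s1\<lparr>mem := (mem s1)(adr L 5 (regs s 10) := ?x), 
       regs := (regs s1)(10 := Suc (regs s 10))\<rparr> else s1)"
    have st: "step w touch s = s2"
      using s' pos 3 t bounds x p cardle by (simp add: touch_def s2_def s1_def c of_bool_def)
    have img: "{..<Suc k} \<inter> {x. x \<noteq> k} = {..<k}" for k :: nat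
      by auto
    show ?thesis
      unfolding st using s' 3 x
      by (auto simp: s2_def s1_def scanned_def serving_def targets_nth img)
  qed
  then show "scanned t S u v (D \<union> targets (rs ! regs s 13)) (Suc p) (step w touch s)"
    "regs (step w touch s) 8 = regs s 8" by auto
qed


lemma scan_code: "loopfree scan_body" "ctime scan_body \<le> 400"
  by (simp_all add: code_defs)

text \<open>The program does not know \<open>d\<close>; it appears only in the termination measure,
  as the radius at which coverage is guaranteed. Each round adds at most two nodes, which gives
  \<open>2 + 2 * k\<close>.\<close>

lemma wp_scan:
  assumes s: "scanned t S u v {} 2 s" and r8: "regs s 8 = 0" and t: "t < T" and d: "d \<le> T"
    and sub: "diff t S \<subseteq> touched rs t d"
  shows "wp w scan (1000 * (d + 1)) (\<lambda>s. \<exists>k\<le>d. regs s 8 = k \<and> diff t S \<subseteq> touched rs t k \<and>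
    scanned t S u v (touched rs t k) (2 + 2 * k) s) s"
  unfolding scan_def
proof (rule wp_While[where
    I = "\<lambda>s. \<exists>k\<le>d. regs s 8 = k \<and> scanned t S u v (touched rs t k) (2 + 2 * k) s"
    and \<mu> = "\<lambda>s. d - regs s 8" and tb = 400])
  show "\<exists>k\<le>d. regs s 8 = k \<and> scanned t S u v (touched rs t k) (2 + 2 * k) s"
    using s r8 by (simp add: touched_0 numeral_2_eq_2)
next
  have fin: "finite (diff t S)" if "scanned t S u v D p s" for D p s
    using that diff_subset[of S t] finite_subset unfolding scanned_def serving_def by blast
  {
    fix s assume "\<exists>k\<le>d. regs s 8 = k \<and> scanned t S u v (touched rs t k) (2 + 2 * k) s"
      and ev: "eval w (Op Less (Reg 9) (Reg 7)) s = 0"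
    then obtain k where k: "k \<le> d" "regs s 8 = k" "scanned t S u v (touched rs t k) (2 + 2 * k) s" by blast
    have "card (diff t S) \<le> card (diff t S \<inter> touched rs t k)"
      using ev k(3) by (simp add: scanned_def serving_def)
    \<comment> \<open>A subset of a finite set with at least as many elements is the whole
      set.\<close>
    then have "diff t S \<inter> touched rs t k = diff t S"
      by (intro card_seteq fin[OF k(3)]) auto
    then show "\<exists>k\<le>d. regs s 8 = k \<and> diff t S \<subseteq> touched rs t k \<and>
      scanned t S u v (touched rs t k) (2 + 2 * k) s" using k by blast
  }
  fix s assume "\<exists>k\<le>d. regs s 8 = k \<and> scanned t S u v (touched rs t k) (2 + 2 * k) s"
      and ev: "eval w (Op Less (Reg 9) (Reg 7)) s \<noteq> 0"
  then obtain k where k: "k \<le> d" "regs s 8 = k" "scanned t S u v (touched rs t k) (2 + 2 * k) s" by blast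
  \<comment> \<open>At radius \<open>d\<close> the counters agree, so the loop test would have
    failed.\<close>
  have "k \<noteq> d"
  proof
    assume "k = d"
    then have "diff t S \<inter> touched rs t k = diff t S" using sub by blast
    then show False using ev k(3) by (simp add: scanned_def serving_def)
  qed
  then have kd: "k < d" using k(1) by simp
  define s1 where "s1 = s\<lparr>regs := (regs s)(8 := Suc k)\<rparr>"
  have s1: "scanned t S u v (touched rs t k) (2 + 2 * k) s1" "regs s1 8 = Suc k"
    using scanned_regs[OF k(3), of 8 "Suc k"] by (auto simp: s1_def)
  define s2 where "s2 = (if k < t then step w touch (s1\<lparr>regs := (regs s1)(13 := t - Suc k)\<rparr>) else s1)"
  define D where "D = touched rs t k \<union> (if k < t \<and> t - Suc k < length rs then targets (rs ! (t - Suc k)) else {})"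
  have s2: "scanned t S u v D (3 + 2 * k) s2 \<and> regs s2 8 = Suc k"
  proof (cases "k < t")
    case True
    have "scanned t S u v (touched rs t k) (2 + 2 * k) (s1\<lparr>regs := (regs s1)(13 := t - Suc k)\<rparr>)"
      by (rule scanned_regs[OF s1(1)]) simp
    from scanned_touch[OF this _ _ t] show ?thesis
      using True t kd d bounds(2) s1(2) len less_imp_diff_less[OF t, of "Suc k"]
      by (simp add: s2_def D_def numeral_3_eq_3)
  next
    case False
    then show ?thesis using s1 by (simp add: s2_def D_def scanned_def)
  qed
  define s3 where "s3 = (if t + k < T then step w touch (s2\<lparr>regs := (regs s2)(13 := t + k)\<rparr>) else s2)"
  have s3: "scanned t S u v (touched rs t (Suc k)) (4 + 2 * k) s3 \<and> regs s3 8 = Suc k"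
  proof (cases "t + k < T")
    case True
    have "scanned t S u v D (3 + 2 * k) (s2\<lparr>regs := (regs s2)(13 := t + k)\<rparr>)"
      by (rule scanned_regs[OF conjunct1[OF s2]]) simp
    from scanned_touch[OF this _ _ t] show ?thesis
      using True t kd d bounds(2) s2 len by (simp add: s3_def D_def touched_Suc)
  next
    case False
    then show ?thesis using s2 len by (simp add: s3_def D_def scanned_def touched_Suc)
  qed
  have p4: "4 + 2 * k = 2 + 2 * Suc k" by simp
  have r: "regs s 6 = t" "okr (regs s)" using k(3) by (auto simp: scanned_def serving_def)
  have r2: "regs s2 6 = t" "okr (regs s2)" using s2 by (auto simp: scanned_def serving_def)
  have "step w scan_body s = s3"
  proof -
    have "step w (block [incr 8,
        If (Op Less (Reg 6) (Reg 8)) Skip (block [Assign 13 (Op Minus (Reg 6) (Reg 8)), touch])]) s = s2"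
      using r k kd d t bounds(2,6) by (simp add: s2_def s1_def)
    moreover have "step w (If (Op Less (Reg 3) (Op Plus (Reg 6) (Reg 8))) Skip
          (block [Assign 13 (Op Minus (Op Plus (Reg 6) (Reg 8)) (Const 1)), touch])) s2 = s3"
      using r2 conjunct2[OF s2] kd d t bounds(2,6) by (simp add: s3_def)
    ultimately show ?thesis by (simp add: scan_body_def)
  qed
  then show "wp w scan_body 400 (\<lambda>s'. (\<exists>k\<le>d. regs s' 8 = k \<and> scanned t S u v (touched rs t k) (2 + 2 * k) s') \<and>
    d - regs s' 8 < d - regs s 8) s"
    using s3[unfolded p4] kd k(2)
    by (intro wp_step[of scan_body] conjI exI[of _ "Suc k"]) (simp_all add: scan_code)
qed simp

section \<open>Graph search on the collected nodes\<close>

lemma cell_index: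
  assumes "x < n" "y < n"
  shows "x * n + y < nn" "(x * n + y) div n = x" "(x * n + y) mod n = y"
proof -
  have "x * n + y < x * n + n" using assms by simp
  also have "\<dots> = Suc x * n" by simp
  also have "\<dots> \<le> n * n" using assms by (intro mult_right_mono) auto
  finally show "x * n + y < nn" .
qed (use assms in auto)

lemma table_index:
  assumes "q < (T + 1) * (T + 1)" "i < nn"
  shows "q * nn + i < M"
proof -
  have "q * nn + i < q * nn + nn" using assms by simp
  also have "\<dots> = Suc q * nn" by simp
  also have "\<dots> \<le> (T + 1) * (T + 1) * nn" using assms by (intro mult_right_mono) auto
  finally show ?thesis by (simp add: M)
qed

lemma serving_regs:
  assumes "serving t b S s" "r \<notin> {2,3,4,5,6,7}"
  shows "serving t b S (s\<lparr>regs := (regs s)(r := x)\<rparr>)"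
  using assms unfolding serving_def by auto

definition joined :: "nat \<Rightarrow> nat \<Rightarrow> nat \<Rightarrow> bool" where
  "joined q = via E (core (q div (T + 1)) (q mod (T + 1)))"

definition reach :: "nat \<Rightarrow> nat set \<Rightarrow> nat \<Rightarrow> nat set" where
  "reach q X u = {y. (u, y) \<in> {(x, y). x \<in> X \<and> y \<in> X \<and> joined q x y}\<^sup>*}"

text \<open>The last clause is the completeness half: a processed node has no undiscovered
  neighbour. The entries of the node array are only permuted, so their set remains
  \<open>X\<close>.\<close>

definition searching :: "nat \<Rightarrow> nat set \<Rightarrow> nat \<Rightarrow> nat \<Rightarrow> nat set \<Rightarrow> nat \<Rightarrow> nat \<Rightarrow> state \<Rightarrow> bool" where
  "searching t S u v X q p s \<longleftrightarrow> serving t (Suc t) S s \<and> regs s 1 = v \<and> regs s 9 = q * nn \<and> regs s 10 = p \<and>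
     regs s 11 \<le> regs s 12 \<and> regs s 12 \<le> p \<and> AR s 5 ` {..<p} = X \<and> u \<in> AR s 5 ` {..<regs s 12} \<and>
     AR s 5 ` {..<regs s 12} \<subseteq> reach q X u \<and>
     (\<forall>i<regs s 11. \<forall>j<p. regs s 12 \<le> j \<longrightarrow> \<not> joined q (AR s 5 i) (AR s 5 j))"

text \<open>The double update is composition with a transposition of \<open>{..<p}\<close>.\<close>

lemma image_swap:
  assumes "b < p" "j < p"
  shows "(f(j := f b, b := f j)) ` {..<p} = f ` {..<p}"
proof -
  have "f(j := f b, b := f j) = f \<circ> Transposition.transpose j b"
    by (auto simp: fun_eq_iff Transposition.transpose_def)
  moreover have "Transposition.transpose j b ` {..<p} = {..<p}"
    using assms by (intro transpose_image_eq) auto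
  ultimately show ?thesis by (metis image_comp)
qed

lemma wp_search_inner:
  assumes s: "searching t S u v X q p s" and a: "regs s 11 = a" "a < regs s 12" and r13: "regs s 13 = regs s 12"
    and X: "X \<subseteq> {..<n}" and q: "q < (T + 1) * (T + 1)" and p: "p + 2 < M"
  shows "wp w search_inner (200 * (p + 1)) (\<lambda>s. searching t S u v X q p s \<and> regs s 11 = a \<and>
     a < regs s 12 \<and> (\<forall>j<p. regs s 12 \<le> j \<longrightarrow> \<not> joined q (AR s 5 a) (AR s 5 j))) s"
  unfolding search_inner_def
proof (rule wp_While[where I = "\<lambda>s. searching t S u v X q p s \<and> regs s 11 = a \<and>
     a < regs s 12 \<and> regs s 12 \<le> regs s 13 \<and> regs s 13 \<le> p \<and>
     (\<forall>j<regs s 13. regs s 12 \<le> j \<longrightarrow> \<not> joined q (AR s 5 a) (AR s 5 j))"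
    and \<mu> = "\<lambda>s. p - regs s 13" and tb = 150])
  show "searching t S u v X q p s \<and> regs s 11 = a \<and>
     a < regs s 12 \<and> regs s 12 \<le> regs s 13 \<and> regs s 13 \<le> p \<and>
     (\<forall>j<regs s 13. regs s 12 \<le> j \<longrightarrow> \<not> joined q (AR s 5 a) (AR s 5 j))"
    using s a r13 by (auto simp: searching_def)
next
  fix s
  assume s: "searching t S u v X q p s \<and> regs s 11 = a \<and>
     a < regs s 12 \<and> regs s 12 \<le> regs s 13 \<and> regs s 13 \<le> p \<and>
     (\<forall>j<regs s 13. regs s 12 \<le> j \<longrightarrow> \<not> joined q (AR s 5 a) (AR s 5 j))"
    and ev: "eval w (Op Less (Reg 13) (Reg 10)) s = 0"
  then show "searching t S u v X q p s \<and> regs s 11 = a \<and>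
     a < regs s 12 \<and> (\<forall>j<p. regs s 12 \<le> j \<longrightarrow> \<not> joined q (AR s 5 a) (AR s 5 j))"
    by (auto simp: searching_def)
next
  fix s
  let ?body = "block [
     If (arr 6 (Op Plus (Reg 9) (Op Plus (Op Times (arr 5 (Reg 11)) (Reg 2)) (arr 5 (Reg 13)))))
       (block [Assign 14 (arr 5 (Reg 13)), put 5 (Reg 13) (arr 5 (Reg 12)), put 5 (Reg 12) (Reg 14), incr 12])
       Skip,
     incr 13]"
  assume s: "searching t S u v X q p s \<and> regs s 11 = a \<and>
     a < regs s 12 \<and> regs s 12 \<le> regs s 13 \<and> regs s 13 \<le> p \<and>
     (\<forall>j<regs s 13. regs s 12 \<le> j \<longrightarrow> \<not> joined q (AR s 5 a) (AR s 5 j))"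
    and ev: "eval w (Op Less (Reg 13) (Reg 10)) s \<noteq> 0"
  have code: "loopfree ?body" "ctime ?body \<le> 150" by (simp_all add: code_defs)
  define N b j where "N = AR s 5" and "b = regs s 12" and "j = regs s 13"
  have sv: "serving t (Suc t) S s" and r: "regs s 9 = q * nn" "regs s 10 = p" "regs s 11 = a"
    "a < b" "b \<le> j" "j < p" "regs s 1 = v"
    and img: "N ` {..<p} = X" "u \<in> N ` {..<b}" "N ` {..<b} \<subseteq> reach q X u"
    and old: "\<And>i j. i < a \<Longrightarrow> j < p \<Longrightarrow> b \<le> j \<Longrightarrow> \<not> joined q (N i) (N j)"
    and new: "\<And>i. i < j \<Longrightarrow> b \<le> i \<Longrightarrow> \<not> joined q (N a) (N i)"
    using s ev unfolding searching_def N_def b_def j_def by auto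
  have ok: "okr (regs s)" using sv by (simp add: serving_def)
  have "N a \<in> X" "N j \<in> X" using r by (auto simp: img(1)[symmetric])
  then have Nn: "N a < n" "N j < n" using X by auto
  have "tab_ok (AR s 6) q" using sv q unfolding serving_def by blast
  then have tab: "AR s 6 (q * nn + (N a * n + N j)) = of_bool (joined q (N a) (N j))"
    unfolding tab_ok_def joined_def using cell_index[OF Nn] by auto
  have i1: "N a * n + N j < nn" "q * nn + (N a * n + N j) < M"
    using cell_index[OF Nn] table_index[OF q] by auto
  show "wp w ?body 150 (\<lambda>s'. (searching t S u v X q p s' \<and> regs s' 11 = a \<and>
     a < regs s' 12 \<and> regs s' 12 \<le> regs s' 13 \<and> regs s' 13 \<le> p \<and>
     (\<forall>j<regs s' 13. regs s' 12 \<le> j \<longrightarrow> \<not> joined q (AR s' 5 a) (AR s' 5 j))) \<and> p - regs s' 13 < p - regs s 13) s"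
  proof (cases "joined q (N a) (N j)")
    case False
    have st: "step w ?body s = s\<lparr>regs := (regs s)(13 := Suc j)\<rparr>"
      using r ok i1 bounds(6) p tab False unfolding N_def j_def b_def by simp
    have "searching t S u v X q p (s\<lparr>regs := (regs s)(13 := Suc j)\<rparr>)"
      using sv r img old unfolding searching_def N_def b_def by (simp add: serving_regs)
    then show ?thesis
      using r new False
      by (intro wp_stepI[OF code st]) (auto simp: less_Suc_eq N_def b_def[symmetric] j_def[symmetric])
  next
    case True
    define N' where "N' = N(j := N b, b := N j)"
    define s' where "s' = step w ?body s"
    have s': "regs s' = (regs s)(14 := N j, 12 := Suc b, 13 := Suc j)"
       "okm (mem s') = okm (mem s)" "\<And>r. r < 8 \<Longrightarrow> r \<noteq> 5 \<Longrightarrow> AR s' r = AR s r"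
       "AR s' 5 = N'"
      using r ok i1 bounds(6) p tab True unfolding s'_def N_def N'_def j_def b_def by simp_all
    have a1: "serving t (Suc t) S s'"
      using sv s' unfolding serving_def by auto
    have a2: "N' ` {..<p} = X" unfolding N'_def using image_swap[of b p j N] r img by simp
    have low: "N' i = N i" if "i < b" for i using that r by (auto simp: N'_def)
    have Nb: "N' b = N j" by (simp add: N'_def)
    have a3: "N' ` {..<Suc b} = insert (N j) (N ` {..<b})"
      using low Nb by (auto simp: lessThan_Suc)
    have "N a \<in> reach q X u" using img r by auto
    moreover have "(N a, N j) \<in> {(x, y). x \<in> X \<and> y \<in> X \<and> joined q x y}"
      using True img(1) r by auto
    ultimately have a4: "N j \<in> reach q X u" unfolding reach_def by (auto intro: rtrancl_into_rtrancl)
    \<comment> \<open>After the swap, position \<open>j\<close> holds the former entry of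
      \<open>b\<close>. That entry was undiscovered too, so \<open>old\<close> and
      \<open>new\<close> at \<open>b\<close> apply to it; processed positions lie below
      \<open>b\<close> and are unchanged.\<close>
    have a5: "\<not> joined q (N' i) (N' k)" if "i < a" "k < p" "Suc b \<le> k" for i k
      using low[of i] old[of i k] old[of i b] that r by (auto simp: N'_def)
    have a6: "\<not> joined q (N' a) (N' i)" if "i < Suc j" "Suc b \<le> i" for i
      using low[of a] new[of i] new[of b] that r by (auto simp: N'_def)
    show ?thesis
    proof (rule wp_step[OF code])
      show "(searching t S u v X q p (step w ?body s) \<and> regs (step w ?body s) 11 = a \<and>
         a < regs (step w ?body s) 12 \<and> regs (step w ?body s) 12 \<le> regs (step w ?body s) 13 \<and>
         regs (step w ?body s) 13 \<le> p \<and>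
         (\<forall>j<regs (step w ?body s) 13. regs (step w ?body s) 12 \<le> j \<longrightarrow>
           \<not> joined q (AR (step w ?body s) 5 a) (AR (step w ?body s) 5 j))) \<and>
         p - regs (step w ?body s) 13 < p - regs s 13"
        unfolding s'_def[symmetric]
        using a1 a2 a3 a4 a5 a6 r img by (auto simp: searching_def s' j_def)
    qed
  qed
next
  show "(p - regs s 13 + 1) * (150 + exp_time (Op Less (Reg 13) (Reg 10)) + 1) \<le> 200 * (p + 1)"
    using mult_le_mono[of "p - regs s 13 + 1" "p + 1" 154 200] by simp
qed


text \<open>Each of at most \<open>p\<close> discovered nodes is compared with at most
  \<open>p\<close> others, one table access per pair, whence the quadratic bound.\<close>

lemma wp_search:
  assumes s: "searching t S u v X q p s" and r11: "regs s 11 = 0"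
    and X: "X \<subseteq> {..<n}" and q: "q < (T + 1) * (T + 1)" and p: "p + 2 < M"
  shows "wp w search (300 * (p + 1) * (p + 1)) (\<lambda>s. serving t (Suc t) S s \<and> regs s 1 = v \<and>
     regs s 12 \<le> p \<and> AR s 5 ` {..<regs s 12} = reach q X u) s"
  unfolding search_def
proof (rule wp_While[where I = "searching t S u v X q p" and \<mu> = "\<lambda>s. p - regs s 11" and tb = "200 * (p + 1) + 20"])
  fix s
  assume s: "searching t S u v X q p s" and ev: "eval w (Op Less (Reg 11) (Reg 12)) s \<noteq> 0"
  define a where "a = regs s 11"
  let ?s1 = "s\<lparr>regs := (regs s)(13 := regs s 12)\<rparr>"
  have s1: "searching t S u v X q p ?s1" "a < regs s 12"
    using s ev by (auto simp: searching_def serving_def a_def)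
  have fin: "wp w (incr 11) 10 (\<lambda>s'. searching t S u v X q p s' \<and> p - regs s' 11 < p - regs s 11) s'"
    if s': "searching t S u v X q p s'" "regs s' 11 = a" "a < regs s' 12"
      "\<forall>j<p. regs s' 12 \<le> j \<longrightarrow> \<not> joined q (AR s' 5 a) (AR s' 5 j)" for s'
    using s' p bounds(6)
    by (intro wp_step) (auto simp: code_defs searching_def serving_def a_def[symmetric] less_Suc_eq)
  have "wp w (Seq search_inner (incr 11)) (200 * (p + 1) + 10)
      (\<lambda>s'. searching t S u v X q p s' \<and> p - regs s' 11 < p - regs s 11) ?s1"
    by (rule wp_Seq_conseq[OF wp_search_inner[OF s1(1) _ _ _ X q p, of a], where ?t2.0 = 10])
      (use s1 fin in \<open>auto simp: a_def\<close>)
  then show "wp w (Seq (Assign 13 (Reg 12)) (Seq search_inner (incr 11))) (200 * (p + 1) + 20)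
      (\<lambda>s'. searching t S u v X q p s' \<and> p - regs s' 11 < p - regs s 11) s"
    by - (rule wp_Seq_step[where ?t2.0 = "200 * (p + 1) + 10"], simp_all)
next
  fix s
  assume s: "searching t S u v X q p s" and ev: "eval w (Op Less (Reg 11) (Reg 12)) s = 0"
  have eq: "regs s 11 = regs s 12" using s ev by (auto simp: searching_def)
  \<comment> \<open>With no pending node, the discovered nodes are closed under adjacency and
    contain \<open>u\<close>, hence include everything reachable.\<close>
  have "y \<in> AR s 5 ` {..<regs s 12}" if "y \<in> reach q X u" for y
    using that unfolding reach_def mem_Collect_eq
  proof (induction rule: rtrancl_induct)
    case base
    then show ?case using s by (simp add: searching_def)
  next
    case (step y z)
    then obtain i where i: "i < regs s 12" "y = AR s 5 i" by auto
    obtain j where j: "j < p" "z = AR s 5 j" using step(2) s unfolding searching_def by auto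
    have "j < regs s 12"
      using s i j step(2) eq unfolding searching_def by (auto simp: not_le[symmetric])
    then show ?case using j by auto
  qed
  then show "serving t (Suc t) S s \<and> regs s 1 = v \<and>
     regs s 12 \<le> p \<and> AR s 5 ` {..<regs s 12} = reach q X u"
    using s unfolding searching_def by auto
next
  have "(p - regs s 11 + 1) * (200 * (p + 1) + 24) \<le> (p + 1) * (300 * (p + 1))"
    by (intro mult_le_mono) auto
  then show "(p - regs s 11 + 1) * (200 * (p + 1) + 20 + exp_time (Op Less (Reg 11) (Reg 12)) + 1)
     \<le> 300 * (p + 1) * (p + 1)"
    by (simp add: algebra_simps)
qed (rule s)

lemma wp_lookup:
  assumes s: "serving t (Suc t) S s" "regs s 1 = v" "regs s 12 = b" "b < M" "regs s 0 = 0" "regs s 11 = 0"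
  shows "wp w lookup (100 * (b + 1)) (\<lambda>s'. serving t (Suc t) S s' \<and> regs s' 0 = of_bool (v \<in> AR s 5 ` {..<b})) s"
  unfolding lookup_def
proof (rule wp_While[where I = "\<lambda>s'. serving t (Suc t) S s' \<and> regs s' 1 = v \<and> regs s' 12 = b \<and> AR s' 5 = AR s 5 \<and>
    regs s' 11 \<le> b \<and> regs s' 0 = of_bool (v \<in> AR s 5 ` {..<regs s' 11})" and \<mu> = "\<lambda>s. b - regs s 11" and tb = 50])
  fix s'
  assume s': "serving t (Suc t) S s' \<and> regs s' 1 = v \<and> regs s' 12 = b \<and> AR s' 5 = AR s 5 \<and>
    regs s' 11 \<le> b \<and> regs s' 0 = of_bool (v \<in> AR s 5 ` {..<regs s' 11})"
    and ev: "eval w (Op Less (Reg 11) (Reg 12)) s' \<noteq> 0"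
  let ?c = "block [If (Op Equal (arr 5 (Reg 11)) (Reg 1)) (Assign 0 (Const 1)) Skip, incr 11]"
  have ok: "okr (regs s')" using s' by (simp add: serving_def)
  have st: "regs (step w ?c s') = (regs s')(0 := of_bool (v \<in> AR s 5 ` {..<Suc (regs s' 11)}), 11 := Suc (regs s' 11))"
      "mem (step w ?c s') = mem s'"
    using s' ev ok \<open>b < M\<close> bounds(6) by (auto simp: lessThan_Suc fun_eq_iff)
  show "wp w ?c 50 (\<lambda>s'a. (serving t (Suc t) S s'a \<and> regs s'a 1 = v \<and> regs s'a 12 = b \<and> AR s'a 5 = AR s 5 \<and>
    regs s'a 11 \<le> b \<and> regs s'a 0 = of_bool (v \<in> AR s 5 ` {..<regs s'a 11})) \<and> b - regs s'a 11 < b - regs s' 11) s'"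
    by (rule wp_step; (unfold serving_def st)?) (use s' ev in \<open>auto simp: code_defs serving_def\<close>)
next
  have "(b - regs s 11 + 1) * (54) \<le> (b + 1) * 100"
    by (intro mult_le_mono) auto
  then show "(b - regs s 11 + 1) * (50 + exp_time (Op Less (Reg 11) (Reg 12)) + 1) \<le> 100 * (b + 1)"
    by simp
qed (use s in auto)


section \<open>Answering a query from the table\<close>

lemma div_mod_block: "k \<le> T \<Longrightarrow> (t * (T + 1) + k) div (T + 1) = t" "k \<le> T \<Longrightarrow> (t * (T + 1) + k) mod (T + 1) = k"
  by (auto simp del: mult_Suc_right simp flip: Suc_eq_plus1 simp: div_mult_self3 less_Suc_eq_le)

lemma block_less:
  assumes "t \<le> T" "k \<le> T"
  shows "t * (T + 1) + k < (T + 1) * (T + 1)"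
proof -
  have "t * (T + 1) + k < t * (T + 1) + (T + 1)" using assms by simp
  also have "\<dots> = (t + 1) * (T + 1)" by simp
  also have "\<dots> \<le> (T + 1) * (T + 1)" using assms by (intro mult_right_mono) auto
  finally show ?thesis .
qed

lemma ev_block_start:
  assumes "okr (regs s)" "regs s 6 = t" "regs s 8 = k" "t \<le> T" "k \<le> T"
  shows "eval w block_start s = (t * (T + 1) + k) * nn"
proof -
  have q: "t * (T + 1) + k < (T + 1) * (T + 1)" by (rule block_less[OF assms(4,5)])
  have "(t * (T + 1) + k) * nn \<le> (T + 1) * (T + 1) * nn" using q by (intro mult_right_mono) auto
  \<comment> \<open>Splitting off (T + 1)^2 bounds the block number separately from the cell
    address, which would say nothing about it for \<open>n = 0\<close>.\<close>
  moreover have "M = (T + 1) * (T + 1) * nn + (T + 1) * (T + 1) + n + 2 * T + 8"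
    by (simp add: M algebra_simps)
  ultimately have "(t * (T + 1) + k) * nn < W" "t * (T + 1) + k < W" "t * (T + 1) < W"
    using q bounds(6) by linarith+
  then show ?thesis
    using assms bounds by (simp add: block_start_def)
qed

text \<open>The part of a query after the window has been found: \<open>S\<close> is the core
  together with the nodes, so connectivity in \<open>G[S]\<close> is reachability in the auxiliary
  graph.\<close>

lemma scanned_query:
  assumes "scanned t S u v (touched rs t k) (2 + 2 * k) s" "regs s 8 = k" "k \<le> d" "d \<le> T" "t < T"
    and sub: "diff t S \<subseteq> touched rs t k" and u: "u \<in> S" "v \<in> S"
  shows "wp w (Seq (block [Assign 9 block_start, Assign 11 (Const 0), Assign 12 (Const 1)])
       (Seq search (Seq (block [Assign 0 (Const 0), Assign 11 (Const 0)]) lookup)))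
       (4000 * (d + 1) * (d + 1))
     (\<lambda>s. serving t (Suc t) S s \<and> regs s 0 = of_bool (connected_in G S u v)) s"
proof -
  let ?q = "t * (T + 1) + k"
  let ?X = "{u, v} \<union> (S \<inter> touched rs t k)"
  note sc = assms(1)[unfolded scanned_def]
  have S: "S \<subseteq> {..<n}" "okr (regs s)" "regs s 6 = t" using sc by (auto simp: serving_def)
  have k: "k \<le> T" "t \<le> T" using assms by auto
  have q: "?q < (T + 1) * (T + 1)" by (rule block_less) (use k in auto)
  have X: "?X \<subseteq> {..<n}" using S u by auto
  \<comment> \<open>Outside the window \<open>S\<close> and \<open>ps t\<close> agree, so there
    \<open>S\<close> coincides with the core; what remains is
    \<open>S \<inter> touched rs t k\<close>, and the endpoints are in \<open>S\<close>
    anyway.\<close>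
  have Sc: "S = core t k \<union> ?X"
    using sub u by (auto simp: core_def diff_def)
  have conn: "connected_in G S u v \<longleftrightarrow> v \<in> reach ?q ?X u"
    using connected_in_iff_via[OF Sc, of u v G] unfolding reach_def joined_def div_mod_block[OF k(1)] by simp
  define p where "p = regs s 10"
  have p: "p \<le> 2 + 2 * d" "0 < p" using sc assms(3) by (auto simp: p_def)
  have pM: "p + 2 < M" using p assms(4) bounds(2) by simp
  let ?c0 = "block [Assign 9 block_start, Assign 11 (Const 0), Assign 12 (Const 1)]"
  define s1 where "s1 = step w ?c0 s"
  have s1: "s1 = s\<lparr>regs := (regs s)(9 := ?q * nn, 11 := 0, 12 := 1)\<rparr>"
    using S(2,3) ev_block_start[OF S(2,3) assms(2)] k by (simp add: s1_def)
  have sv1: "serving t (Suc t) S s1"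
    using sc unfolding s1 serving_def by simp
  have "AR s 5 ` {..<Suc 0} = {u}" using sc by (auto simp: lessThan_Suc)
  then have "searching t S u v ?X ?q p s1"
    using sc sv1 p unfolding searching_def by (simp add: s1 reach_def p_def)
  moreover have "regs s1 11 = 0" by (simp add: s1)
  ultimately have search: "wp w search (300 * (p + 1) * (p + 1)) (\<lambda>s. serving t (Suc t) S s \<and> regs s 1 = v \<and>
     regs s 12 \<le> p \<and> AR s 5 ` {..<regs s 12} = reach ?q ?X u) s1"
    by (rule wp_search[OF _ _ X q pM])
  have look: "wp w (Seq (block [Assign 0 (Const 0), Assign 11 (Const 0)]) lookup) (10 + 100 * (p + 1))
     (\<lambda>s. serving t (Suc t) S s \<and> regs s 0 = of_bool (connected_in G S u v)) s2"
    if s2: "serving t (Suc t) S s2 \<and> regs s2 1 = v \<and>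
     regs s2 12 \<le> p \<and> AR s2 5 ` {..<regs s2 12} = reach ?q ?X u" for s2
  proof (rule wp_Seq_step[where ?t2.0 = "100 * (p + 1)"])
    let ?s3 = "step w (block [Assign 0 (Const 0), Assign 11 (Const 0)]) s2"
    have s3: "?s3 = s2\<lparr>regs := (regs s2)(0 := 0, 11 := 0)\<rparr>" by simp
    have sv3: "serving t (Suc t) S ?s3" using s2 unfolding s3 serving_def by simp
    have "regs ?s3 1 = v" "regs ?s3 12 = regs s2 12" "regs s2 12 < M" "regs ?s3 0 = 0" "regs ?s3 11 = 0"
      using s2 pM unfolding s3 by auto
    note look = wp_lookup[OF sv3 this]
    show "wp w lookup (100 * (p + 1)) (\<lambda>s. serving t (Suc t) S s \<and> regs s 0 = of_bool (connected_in G S u v)) ?s3"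
      by (rule wp_conseq[OF look]) (use s2 conn in \<open>auto\<close>)
  qed simp_all
  \<comment> \<open>Since \<open>p \<le> 2 * d + 2\<close>, the left side is at most 300 * (2 * d +
    3)^2 plus linear terms; 4000 dominates coefficient by coefficient.\<close>
  have "300 * (p + 1) * (p + 1) + (10 + 100 * (p + 1)) + 50 \<le> 4000 * (d + 1) * (d + 1)"
  proof -
    have "(p + 1) * (p + 1) \<le> (3 + 2 * d) * (3 + 2 * d)" using p by (intro mult_le_mono) auto
    then have "300 * (p + 1) * (p + 1) + (10 + 100 * (p + 1)) + 50 \<le> 300 * ((3 + 2 * d) * (3 + 2 * d)) + (10 + 100 * (3 + 2 * d)) + 50"
      using p by (simp add: algebra_simps)
    also have "\<dots> \<le> 4000 * (d + 1) * (d + 1)" by (simp add: algebra_simps)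
    finally show ?thesis .
  qed
  then show ?thesis
    by (intro wp_Seq_step[where ?t2.0 = "300 * (p + 1) * (p + 1) + (10 + 100 * (p + 1))"]
        wp_Seq_conseq[OF search[unfolded s1_def] look])
      (simp_all add: block_start_def)
qed

lemma serving_query:
  assumes s: "serving t t S s" and uv: "regs s 0 = u" "regs s 1 = v" "u < n" "v < n"
    and t: "t < T" and d: "d \<le> T" and sub: "diff t S \<subseteq> touched rs t d"
  shows "wp w query (6000 * (d + 1) * (d + 1))
     (\<lambda>s. serving (Suc t) (Suc t) S s \<and> regs s 0 = of_bool (connected_in G S u v)) s"
proof -
  note s' = s[unfolded serving_def]
  have adv: "wp w advance 200 (\<lambda>s. serving (Suc t) (Suc t) S s \<and> regs s 0 = of_bool (connected_in G S u v)) s1"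
    if "serving t (Suc t) S s1 \<and> regs s1 0 = of_bool (connected_in G S u v)" for s1
    by (rule wp_step) (use that serving_advance[of t "Suc t" S s1] t in \<open>auto simp: code_defs\<close>)
  let ?b = "Op Times (arr 0 (Reg 0)) (arr 0 (Reg 1))"
  have ev: "eval w ?b s = of_bool (u \<in> S \<and> v \<in> S)"
    using s' uv bounds(1,6) by simp
  show ?thesis
    unfolding query_def
  proof (rule wp_Seq_conseq[OF _ adv, where ?t1.0 = "5800 * (d + 1) * (d + 1)"])
    show "wp w
     (If ?b
       (Seq (block [put 5 (Const 0) (Reg 0), put 5 (Const 1) (Reg 1), Assign 8 (Const 0),
               Assign 9 (Const 0), Assign 10 (Const 2)])
       (Seq scan
       (Seq (block [Assign 9 block_start, Assign 11 (Const 0), Assign 12 (Const 1)])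
       (Seq search
       (Seq (block [Assign 0 (Const 0), Assign 11 (Const 0)])
       lookup)))))
       (Assign 0 (Const 0))) (5800 * (d + 1) * (d + 1))
      (\<lambda>s. serving t (Suc t) S s \<and> regs s 0 = of_bool (connected_in G S u v)) s"
    proof (rule wp_If[where t = "1000 * (d + 1) + 4000 * (d + 1) * (d + 1) + 100"])
      assume "eval w ?b s = 0"
      then have "\<not> (u \<in> S \<and> v \<in> S)" unfolding ev by simp
      then have "\<not> connected_in G S u v"
        unfolding connected_in_def reachable_def using in_rtrancl_on_in_F by fastforce
      moreover have "serving t (Suc t) S (s\<lparr>regs := (regs s)(0 := 0)\<rparr>)"
        using s' unfolding serving_def by (auto simp: le_SucI)
      ultimately show "wp w (Assign 0 (Const 0)) (1000 * (d + 1) + 4000 * (d + 1) * (d + 1) + 100)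
        (\<lambda>s. serving t (Suc t) S s \<and> regs s 0 = of_bool (connected_in G S u v)) s"
        by (intro wp_step) auto
    next
      assume "eval w ?b s \<noteq> 0"
      then have uS: "u \<in> S" "v \<in> S" unfolding ev by auto
      let ?c0 = "block [put 5 (Const 0) (Reg 0), put 5 (Const 1) (Reg 1), Assign 8 (Const 0),
               Assign 9 (Const 0), Assign 10 (Const 2)]"
      define s1 where "s1 = step w ?c0 s"
      have s1: "s1 = s\<lparr>mem := (mem s)(adr L 5 0 := u, adr L 5 1 := v), regs := (regs s)(8 := 0, 9 := 0, 10 := 2)\<rparr>"
        using s' uv bounds(1) by (simp add: s1_def)
      have "{..<2} = {0, 1::nat}" by auto
      then have "AR s1 5 ` {..<2} = {u, v}" by (auto simp: s1)
      moreover have "serving t (Suc t) S s1"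
        using s' by (simp add: s1 serving_def le_SucI)
      \<comment> \<open>Stamps were bounded by \<open>t\<close> before the query, so initially no
        vertex counts as seen.\<close>
      moreover have "\<forall>x<n. AR s1 2 x \<noteq> Suc t"
        using s' by (force simp: s1)
      ultimately have "scanned t S u v {} 2 s1"
        unfolding scanned_def using uv by (simp add: s1)
      then have sc: "wp w scan (1000 * (d + 1)) (\<lambda>s. \<exists>k\<le>d. regs s 8 = k \<and> diff t S \<subseteq> touched rs t k \<and>
        scanned t S u v (touched rs t k) (2 + 2 * k) s) (step w ?c0 s)"
        unfolding s1_def[symmetric] by (rule wp_scan[OF _ _ t d sub]) (simp add: s1)
      show "wp w (Seq ?c0
       (Seq scan
       (Seq (block [Assign 9 block_start, Assign 11 (Const 0), Assign 12 (Const 1)])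
       (Seq search
       (Seq (block [Assign 0 (Const 0), Assign 11 (Const 0)])
       lookup))))) (1000 * (d + 1) + 4000 * (d + 1) * (d + 1) + 100)
        (\<lambda>s. serving t (Suc t) S s \<and> regs s 0 = of_bool (connected_in G S u v)) s"
      proof (rule wp_Seq_step[OF _ wp_Seq_conseq[OF sc, where t = "1000 * (d + 1) + 4000 * (d + 1) * (d + 1)"]])
        fix s2
        assume "\<exists>k\<le>d. regs s2 8 = k \<and> diff t S \<subseteq> touched rs t k \<and>
          scanned t S u v (touched rs t k) (2 + 2 * k) s2"
        then show "wp w (Seq (block [Assign 9 block_start, Assign 11 (Const 0), Assign 12 (Const 1)])
           (Seq search (Seq (block [Assign 0 (Const 0), Assign 11 (Const 0)]) lookup)))
            (4000 * (d + 1) * (d + 1))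
           (\<lambda>s. serving t (Suc t) S s \<and> regs s 0 = of_bool (connected_in G S u v)) s2"
          using scanned_query[OF _ _ _ d t _ uS] by blast
      qed (simp_all add: code_defs)
    next
      show "exp_time ?b + 1 + (1000 * (d + 1) + 4000 * (d + 1) * (d + 1) + 100) \<le> 5800 * (d + 1) * (d + 1)"
        by (simp add: code_defs algebra_simps)
    qed
  qed (simp_all add: algebra_simps)
qed

subsection \<open>Preprocessing\<close>

text \<open>\<open>t\<close> is the time of the predicted set in array 3, and \<open>q\<close> the
  number of finished table blocks. Arrays 1 and 2 and register 7 must still be zero to start
  serving.\<close>

definition prepping :: "nat \<Rightarrow> nat \<Rightarrow> state \<Rightarrow> bool" where
  "prepping t q s \<longleftrightarrow> okr (regs s) \<and> okm (mem s) \<and> regs s 6 = t \<and> regs s 7 = 0 \<and>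
     (\<forall>v<n. AR s 0 v = of_bool (v \<in> S0)) \<and> (\<forall>v<n. AR s 1 v = 0) \<and> (\<forall>v<n. AR s 2 v = 0) \<and>
     (\<forall>v<n. AR s 3 v = of_bool (v \<in> ps t)) \<and> (\<forall>q'<q. tab_ok (AR s 6) q')"

definition in_block :: "nat \<Rightarrow> nat \<Rightarrow> nat \<Rightarrow> nat set \<Rightarrow> state \<Rightarrow> bool" where
  "in_block t k q C s \<longleftrightarrow> prepping t q s \<and> regs s 8 = k \<and> regs s 9 = q * nn \<and>
     (\<forall>v<n. AR s 4 v = of_bool (v \<in> C))"

abbreviation cell :: "state \<Rightarrow> nat \<Rightarrow> nat \<Rightarrow> nat" where
  "cell s q i \<equiv> AR s 6 (q * nn + i)"

text \<open>Blocks are consecutive, so writing at or beyond the start of block \<open>q\<close>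
  leaves all earlier blocks intact.\<close>

lemma tab_ok_upd: "q' < q \<Longrightarrow> tab_ok (f(q * nn + i := x)) q' = tab_ok f q'"
proof -
  assume "q' < q"
  then have "Suc q' * nn \<le> q * nn" by (intro mult_right_mono) auto
  then have "j < nn \<Longrightarrow> q' * nn + j \<noteq> q * nn + i" for j by simp
  then show ?thesis unfolding tab_ok_def by auto
qed

lemma in_block_regs:
  "in_block t k q C s \<Longrightarrow> r \<in> {10, 11, 12, 13, 14} \<Longrightarrow> in_block t k q C (s\<lparr>regs := (regs s)(r := x)\<rparr>)"
  unfolding in_block_def prepping_def by auto

lemma in_block_cell:
  "in_block t k q C s \<Longrightarrow> in_block t k q C (s\<lparr>mem := (mem s)(adr L 6 (q * nn + i) := x)\<rparr>)"
  unfolding in_block_def prepping_def by (auto simp: tab_ok_upd)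

lemma wp_init_block:
  assumes s: "in_block t k q C s" "regs s 11 = 0" and q: "q < (T + 1) * (T + 1)"
  shows "wp w init_block (200 * (nn + 1)) (\<lambda>s. in_block t k q C s \<and>
    (\<forall>i<nn. cell s q i = of_bool (via E {} (i div n) (i mod n)))) s"
  unfolding init_block_def
proof (rule wp_While[where I = "\<lambda>s. in_block t k q C s \<and> regs s 11 \<le> nn \<and>
     (\<forall>i<regs s 11. cell s q i = of_bool (via E {} (i div n) (i mod n)))" and \<mu> = "\<lambda>s. nn - regs s 11" and tb = 150])
  fix s
  let ?b = "Op Less (Reg 11) (Op Times (Reg 2) (Reg 2))"
  have ok: "okr (regs s)" "okm (mem s)" if "in_block t k q C s"
    using that by (auto simp: in_block_def prepping_def)
  {
    assume "in_block t k q C s \<and> regs s 11 \<le> nn \<and>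
       (\<forall>i<regs s 11. cell s q i = of_bool (via E {} (i div n) (i mod n)))"
      and "eval w ?b s = 0"
    then show "in_block t k q C s \<and> (\<forall>i<nn. cell s q i = of_bool (via E {} (i div n) (i mod n)))"
      using ok bounds(5,6) by simp
  }
  assume s: "in_block t k q C s \<and> regs s 11 \<le> nn \<and>
       (\<forall>i<regs s 11. cell s q i = of_bool (via E {} (i div n) (i mod n)))"
    and ev: "eval w ?b s \<noteq> 0"
  define i where "i = regs s 11"
  have i: "i < nn" using s ev ok bounds(5,6) by (simp add: i_def)
  have n0: "0 < n" using i by (cases n) auto
  have dm: "i div n < n" "i mod n < n"
    using i n0 by (auto simp: less_mult_imp_div_less)
  let ?c = "block [
     put 6 (Op Plus (Reg 9) (Reg 11)) (Mem (Reg 11)),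
     If (Op Equal (Op Div (Reg 11) (Reg 2)) (Op Mod (Reg 11) (Reg 2)))
       (put 6 (Op Plus (Reg 9) (Reg 11)) (Const 1)) Skip,
     incr 11]"
  define s' where "s' = step w ?c s"
  have ix: "q * nn + i < M" by (rule table_index[OF q i])
  have m: "mem s i = of_bool (E (i div n) (i mod n))"
    using ok s i by (auto simp: okm_def)
  have r9: "regs s 9 = q * nn" using s by (auto simp: in_block_def)
  define s1 where "s1 = s\<lparr>mem := (mem s)(adr L 6 (q * nn + i) := of_bool (via E {} (i div n) (i mod n)))\<rparr>"
  have s': "s' = s1\<lparr>regs := (regs s1)(11 := Suc i)\<rparr>"
  proof -
    have "i div n < W" "i mod n < W" using dm bounds(1,6) by linarith+
    then show ?thesis
      using conjunct1[OF s] ok ix i r9 m bounds(5,6) unfolding s'_def s1_def i_def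
      by (cases "regs s 11 div n = regs s 11 mod n") (simp_all add: via_empty)
  qed
  have s1: "in_block t k q C s1"
    unfolding s1_def by (rule in_block_cell) (use s in simp)
  have "in_block t k q C s'"
    unfolding s' by (rule in_block_regs[OF s1]) simp
  moreover have "\<forall>j<Suc i. cell s' q j = of_bool (via E {} (j div n) (j mod n))"
    using s unfolding s' s1_def by (auto simp: i_def less_Suc_eq)
  moreover have "regs s' 11 = Suc i" by (simp add: s')
  ultimately have Q: "(in_block t k q C s' \<and> regs s' 11 \<le> nn \<and>
       (\<forall>i<regs s' 11. cell s' q i = of_bool (via E {} (i div n) (i mod n)))) \<and> nn - regs s' 11 < nn - regs s 11"
    using i by (simp add: i_def[symmetric])
  show "wp w ?c 150 (\<lambda>s'. (in_block t k q C s' \<and> regs s' 11 \<le> nn \<and>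
       (\<forall>i<regs s' 11. cell s' q i = of_bool (via E {} (i div n) (i mod n)))) \<and> nn - regs s' 11 < nn - regs s 11) s"
    by (rule wp_stepI[OF _ _ s'_def[symmetric]]; (rule Q)?) (simp_all add: code_defs)
qed (use s in \<open>auto\<close>)

text \<open>The pass works in place, so entries of row and column \<open>z\<close> may be read
  before or after their own update. This is sound because every entry always lies between the
  relations for \<open>A\<close> and for \<open>insert z A\<close>, and \<open>z\<close> may be used
  as a cut point in both.\<close>

lemma wp_warshall_inner:
  assumes s: "in_block t k q C s" "regs s 11 = 0" "regs s 10 = z" and q: "q < (T + 1) * (T + 1)" and z: "z < n"
    and A: "\<forall>i<nn. cell s q i = of_bool (via E A (i div n) (i mod n))"
  shows "wp w warshall_inner (200 * (nn + 1)) (\<lambda>s. in_block t k q C s \<and> regs s 10 = z \<and>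
    (\<forall>i<nn. cell s q i = of_bool (via E (insert z A) (i div n) (i mod n)))) s"
  unfolding warshall_inner_def
proof (rule wp_While[where I = "\<lambda>s. in_block t k q C s \<and> regs s 10 = z \<and> regs s 11 \<le> nn \<and>
     (\<forall>i<nn. (cell s q i = 0 \<or> cell s q i = 1 \<and> via E (insert z A) (i div n) (i mod n)) \<and>
       (via E A (i div n) (i mod n) \<longrightarrow> cell s q i = 1) \<and>
       (i < regs s 11 \<longrightarrow> via E (insert z A) (i div n) (i mod n) \<longrightarrow> cell s q i = 1))"
    and \<mu> = "\<lambda>s. nn - regs s 11" and tb = 150])
  show "in_block t k q C s \<and> regs s 10 = z \<and> regs s 11 \<le> nn \<and>
     (\<forall>i<nn. (cell s q i = 0 \<or> cell s q i = 1 \<and> via E (insert z A) (i div n) (i mod n)) \<and>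
       (via E A (i div n) (i mod n) \<longrightarrow> cell s q i = 1) \<and>
       (i < regs s 11 \<longrightarrow> via E (insert z A) (i div n) (i mod n) \<longrightarrow> cell s q i = 1))"
    using s A by (auto simp: via_insert)
next
  fix s
  let ?b = "Op Less (Reg 11) (Op Times (Reg 2) (Reg 2))"
  let ?I = "\<lambda>s. in_block t k q C s \<and> regs s 10 = z \<and> regs s 11 \<le> nn \<and>
     (\<forall>i<nn. (cell s q i = 0 \<or> cell s q i = 1 \<and> via E (insert z A) (i div n) (i mod n)) \<and>
       (via E A (i div n) (i mod n) \<longrightarrow> cell s q i = 1) \<and>
       (i < regs s 11 \<longrightarrow> via E (insert z A) (i div n) (i mod n) \<longrightarrow> cell s q i = 1))"
  have ok: "okr (regs s)" "okm (mem s)" if "in_block t k q C s"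
    using that by (auto simp: in_block_def prepping_def)
  {
    assume I: "?I s" and "eval w ?b s = 0"
    then have "regs s 11 = nn" using ok bounds(5,6) by simp
    with I show "in_block t k q C s \<and> regs s 10 = z \<and> (\<forall>i<nn. cell s q i = of_bool (via E (insert z A) (i div n) (i mod n)))"
      by force
  }
  assume I: "?I s" and ev: "eval w ?b s \<noteq> 0"
  define i where "i = regs s 11"
  have i: "i < nn" using I ev ok bounds(5,6) by (simp add: i_def)
  have n0: "0 < n" using i by (cases n) auto
  define x y where "x = i div n" and "y = i mod n"
  have xy: "x < n" "y < n"
    using i n0 by (auto simp: x_def y_def less_mult_imp_div_less)
  note ixz = cell_index[OF xy(1) z] and izy = cell_index[OF z xy(2)]
  note ix = table_index[OF q i] table_index[OF q ixz(1)] table_index[OF q izy(1)]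
  let ?c = "block [
     If (Op Times
          (arr 6 (Op Plus (Reg 9) (Op Plus (Op Times (Op Div (Reg 11) (Reg 2)) (Reg 2)) (Reg 10))))
          (arr 6 (Op Plus (Reg 9) (Op Plus (Op Times (Reg 10) (Reg 2)) (Op Mod (Reg 11) (Reg 2))))))
       (put 6 (Op Plus (Reg 9) (Reg 11)) (Const 1)) Skip,
     incr 11]"
  have r: "regs s 9 = q * nn" "regs s 10 = z" "okr (regs s)" "regs s 11 = i"
    using I ok by (auto simp: in_block_def i_def)
  have xz: "cell s q (x * n + z) = 0 \<or> cell s q (x * n + z) = 1 \<and> via E (insert z A) x z"
       "via E A x z \<Longrightarrow> cell s q (x * n + z) = 1"
    and zy: "cell s q (z * n + y) = 0 \<or> cell s q (z * n + y) = 1 \<and> via E (insert z A) z y"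
       "via E A z y \<Longrightarrow> cell s q (z * n + y) = 1"
    using I ixz izy by metis+
  have old: "via E A x y \<longrightarrow> cell s q i = 1" using I i x_def y_def by blast
  define P where "P \<longleftrightarrow> cell s q (x * n + z) = 1 \<and> cell s q (z * n + y) = 1"
  define s1 where "s1 = (if P then s\<lparr>mem := (mem s)(adr L 6 (q * nn + i) := 1)\<rparr> else s)"
  have st: "step w ?c s = s1\<lparr>regs := (regs s1)(11 := Suc i)\<rparr>"
  proof -
    have e1: "eval w (arr 6 (Op Plus (Reg 9) (Op Plus (Op Times (Op Div (Reg 11) (Reg 2)) (Reg 2)) (Reg 10)))) s
        = cell s q (x * n + z)"
      using r ix(2) ixz(1) i xy bounds(1,5,6) by (simp add: x_def[symmetric])
    have e2: "eval w (arr 6 (Op Plus (Reg 9) (Op Plus (Op Times (Reg 10) (Reg 2)) (Op Mod (Reg 11) (Reg 2))))) s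
        = cell s q (z * n + y)"
      using r ix(3) izy(1) i xy bounds(1,5,6) by (simp add: y_def[symmetric])
    show ?thesis
      using xz(1) zy(1) r ix(1) i bounds(5,6) by (auto simp: e1 e2 s1_def P_def)
  qed
  have b1: "in_block t k q C s1"
    unfolding s1_def using I in_block_cell[of t k q C s] by simp
  have b2: "in_block t k q C (s1\<lparr>regs := (regs s1)(11 := Suc i)\<rparr>)"
    by (rule in_block_regs[OF b1]) simp
  have sound: "via E (insert z A) x y" if P
    using that xz zy unfolding P_def by (auto intro: via_trans[where z = z])
  \<comment> \<open>\<open>via_insert\<close> offers a path avoiding \<open>z\<close>, which is
    recorded already, or two halves with interior in \<open>A\<close>, whose entries are
    \<open>1\<close> whether updated or not.\<close>
  have complete: "P \<or> cell s q i = 1" if "via E (insert z A) x y"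
    using that old xz(2) zy(2) unfolding via_insert P_def by blast
  have cells: "cell s1 q j = (if P \<and> j = i then 1 else cell s q j)" for j
    by (simp add: s1_def)
  have new: "(cell s1 q j = 0 \<or> cell s1 q j = 1 \<and> via E (insert z A) (j div n) (j mod n)) \<and>
       (via E A (j div n) (j mod n) \<longrightarrow> cell s1 q j = 1) \<and>
       (j < Suc i \<longrightarrow> via E (insert z A) (j div n) (j mod n) \<longrightarrow> cell s1 q j = 1)" if "j < nn" for j
  proof (cases "j = i")
    case True
    then show ?thesis
      using I i sound complete old unfolding cells by (auto simp: x_def[symmetric] y_def[symmetric])
  next
    case False
    then show ?thesis
      using I that unfolding cells by (auto simp: less_Suc_eq i_def)
  qed
  have r1: "regs s1 10 = z" using r by (simp add: s1_def)
  show "wp w ?c 150 (\<lambda>s'. ?I s' \<and> nn - regs s' 11 < nn - regs s 11) s"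
  proof (rule wp_stepI[OF _ _ st])
    show "?I (s1\<lparr>regs := (regs s1)(11 := Suc i)\<rparr>) \<and>
      nn - regs (s1\<lparr>regs := (regs s1)(11 := Suc i)\<rparr>) 11 < nn - regs s 11"
      using b2 new i r r1 by simp
  qed (simp_all add: code_defs)
qed (use s in \<open>auto\<close>)

lemma wp_warshall:
  assumes s: "in_block t k q C s" "regs s 10 = 0" and q: "q < (T + 1) * (T + 1)" and C: "C \<subseteq> {..<n}"
    and A: "\<forall>i<nn. cell s q i = of_bool (via E {} (i div n) (i mod n))"
  shows "wp w warshall ((n + 1) * (200 * (nn + 1) + 100)) (\<lambda>s. in_block t k q C s \<and>
    (\<forall>i<nn. cell s q i = of_bool (via E C (i div n) (i mod n)))) s"
  unfolding warshall_def
proof (rule wp_While[where I = "\<lambda>s. in_block t k q C s \<and> regs s 10 \<le> n \<and>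
     (\<forall>i<nn. cell s q i = of_bool (via E (C \<inter> {..<regs s 10}) (i div n) (i mod n)))"
    and \<mu> = "\<lambda>s. n - regs s 10" and tb = "200 * (nn + 1) + 90"])
  fix s
  let ?I = "\<lambda>s. in_block t k q C s \<and> regs s 10 \<le> n \<and>
     (\<forall>i<nn. cell s q i = of_bool (via E (C \<inter> {..<regs s 10}) (i div n) (i mod n)))"
  have ok: "okr (regs s)" if "in_block t k q C s"
    using that by (auto simp: in_block_def prepping_def)
  {
    assume I: "?I s" and "eval w (Op Less (Reg 10) (Reg 2)) s = 0"
    then have "regs s 10 = n" using ok by simp
    moreover have "C \<inter> {..<n} = C" using C by auto
    ultimately show "in_block t k q C s \<and> (\<forall>i<nn. cell s q i = of_bool (via E C (i div n) (i mod n)))"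
      using I by simp
  }
  assume I: "?I s" and ev: "eval w (Op Less (Reg 10) (Reg 2)) s \<noteq> 0"
  define z where "z = regs s 10"
  have z: "z < n" using ev I ok by (simp add: z_def)
  have a4: "eval w (arr 4 (Reg 10)) s = of_bool (z \<in> C)"
    using I ok z bounds(1) by (auto simp: z_def[symmetric] in_block_def)
  have Cs: "C \<inter> {..<Suc z} = (if z \<in> C then insert z (C \<inter> {..<z}) else C \<inter> {..<z})"
    by (auto simp: less_Suc_eq)
  show "wp w (Seq (If (arr 4 (Reg 10)) (Seq (Assign 11 (Const 0)) warshall_inner) Skip) (incr 10)) (200 * (nn + 1) + 90)
     (\<lambda>s'. ?I s' \<and> n - regs s' 10 < n - regs s 10) s"
  proof (rule wp_Seq_conseq[where R = "\<lambda>s. in_block t k q C s \<and> regs s 10 = z \<and>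
      (\<forall>i<nn. cell s q i = of_bool (via E (C \<inter> {..<Suc z}) (i div n) (i mod n)))"
      and ?t1.0 = "200 * (nn + 1) + 80" and ?t2.0 = 10])
    show "wp w (If (arr 4 (Reg 10)) (Seq (Assign 11 (Const 0)) warshall_inner) Skip) (200 * (nn + 1) + 80)
      (\<lambda>s. in_block t k q C s \<and> regs s 10 = z \<and>
      (\<forall>i<nn. cell s q i = of_bool (via E (C \<inter> {..<Suc z}) (i div n) (i mod n)))) s"
    proof (rule wp_If[where t = "200 * (nn + 1) + 10"])
      assume "eval w (arr 4 (Reg 10)) s \<noteq> 0"
      then have zC: "z \<in> C" unfolding a4 by simp
      let ?s1 = "s\<lparr>regs := (regs s)(11 := 0)\<rparr>"
      have s1: "in_block t k q C ?s1" by (rule in_block_regs) (use I in auto)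
      have "wp w warshall_inner (200 * (nn + 1)) (\<lambda>s. in_block t k q C s \<and> regs s 10 = z \<and>
         (\<forall>i<nn. cell s q i = of_bool (via E (insert z (C \<inter> {..<z})) (i div n) (i mod n)))) ?s1"
        by (rule wp_warshall_inner[OF s1 _ _ q z]) (use I in \<open>auto simp: z_def\<close>)
      then show "wp w (Seq (Assign 11 (Const 0)) warshall_inner) (200 * (nn + 1) + 10)
        (\<lambda>s. in_block t k q C s \<and> regs s 10 = z \<and>
        (\<forall>i<nn. cell s q i = of_bool (via E (C \<inter> {..<Suc z}) (i div n) (i mod n)))) s"
        unfolding Cs using zC by - (rule wp_Seq_step[where ?t2.0 = "200 * (nn + 1)"], simp_all)
    next
      assume "eval w (arr 4 (Reg 10)) s = 0"
      then have zC: "z \<notin> C" unfolding a4 by simp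
      show "wp w Skip (200 * (nn + 1) + 10)
        (\<lambda>s. in_block t k q C s \<and> regs s 10 = z \<and>
        (\<forall>i<nn. cell s q i = of_bool (via E (C \<inter> {..<Suc z}) (i div n) (i mod n)))) s"
        unfolding Cs using zC I by (intro wp_step) (simp_all add: z_def)
    qed (simp add: code_defs)
  next
    fix s' assume s': "in_block t k q C s' \<and> regs s' 10 = z \<and>
      (\<forall>i<nn. cell s' q i = of_bool (via E (C \<inter> {..<Suc z}) (i div n) (i mod n)))"
    have "in_block t k q C (s'\<lparr>regs := (regs s')(10 := Suc z)\<rparr>)"
      by (rule in_block_regs) (use s' in auto)
    moreover have "step w (incr 10) s' = s'\<lparr>regs := (regs s')(10 := Suc z)\<rparr>"
      using s' z bounds(1,6) by simp
    ultimately show "wp w (incr 10) 10 (\<lambda>s'. ?I s' \<and> n - regs s' 10 < n - regs s 10) s'"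
      using s' z by (intro wp_stepI[of "incr 10"]) (auto simp: incr_def z_def[symmetric])
  qed simp
next
  show "(n - regs s 10 + 1) * (200 * (nn + 1) + 90 + exp_time (Op Less (Reg 10) (Reg 2)) + 1)
    \<le> (n + 1) * (200 * (nn + 1) + 100)"
    by (intro mult_le_mono) auto
qed (use s A in \<open>auto\<close>)


section \<open>Shrinking the core and filling the table\<close>

lemma in_block_untouch:
  assumes s: "in_block t k q C s" and pos: "regs s 13 < T"
  shows "in_block t k q (C - targets (rs ! regs s 13)) (step w untouch s) \<and> AR (step w untouch s) 6 = AR s 6"
proof -
  note s' = s[unfolded in_block_def prepping_def]
  show ?thesis
  proof (cases "ty (regs s 13) < 2")
    case True
    have st: "step w untouch s = s\<lparr>mem := (mem s)(adr L 4 (vx (regs s 13)) := 0)\<rparr>"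
      using s' pos vx_less[OF pos True] True bounds(1) by (simp add: untouch_def)
    show ?thesis
      unfolding st in_block_def prepping_def using s' True by (simp add: targets_nth)
  next
    case False
    then have "step w untouch s = s" using s' pos by (simp add: untouch_def)
    then show ?thesis using s False by (simp add: targets_nth)
  qed
qed

lemma shrink_core_code: "loopfree shrink_core" "ctime shrink_core \<le> 200"
  by (simp_all add: code_defs)

text \<open>The core is updated at the same two window ends that a query scans, so block
  \<open>k\<close> describes exactly the core of a query stopping at radius
  \<open>k\<close>.\<close>

lemma in_block_shrink_core:
  assumes s: "in_block t k q (core t k) s" and t: "t \<le> T" and k: "k \<le> T"
  shows "in_block t (Suc k) q (core t (Suc k)) (step w shrink_core s) \<and> AR (step w shrink_core s) 6 = AR s 6"
proof -
  define s1 where "s1 = s\<lparr>regs := (regs s)(8 := Suc k)\<rparr>"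
  have s1: "in_block t (Suc k) q (core t k) s1" and m1: "AR s1 6 = AR s 6"
    using s unfolding s1_def in_block_def prepping_def by auto
  define s2 where "s2 = (if k < t then step w untouch (s1\<lparr>regs := (regs s1)(13 := t - Suc k)\<rparr>) else s1)"
  define D where "D = core t k - (if k < t \<and> t - Suc k < length rs then targets (rs ! (t - Suc k)) else {})"
  have s2: "in_block t (Suc k) q D s2 \<and> AR s2 6 = AR s 6"
  proof (cases "k < t")
    case True
    then have lt: "t - Suc k < T" using t by simp
    have "in_block t (Suc k) q (core t k) (s1\<lparr>regs := (regs s1)(13 := t - Suc k)\<rparr>)"
      by (rule in_block_regs[OF s1]) simp
    from in_block_untouch[OF this] show ?thesis
      using True lt len m1 by (simp add: s2_def D_def)
  next
    case False
    then show ?thesis using s1 m1 by (simp add: s2_def D_def)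
  qed
  define s3 where "s3 = (if t + k < T then step w untouch (s2\<lparr>regs := (regs s2)(13 := t + k)\<rparr>) else s2)"
  have cs: "core t (Suc k) = D - (if t + k < length rs then targets (rs ! (t + k)) else {})"
    unfolding core_def D_def touched_Suc by auto
  have s3: "in_block t (Suc k) q (core t (Suc k)) s3 \<and> AR s3 6 = AR s 6"
  proof (cases "t + k < T")
    case True
    have "in_block t (Suc k) q D (s2\<lparr>regs := (regs s2)(13 := t + k)\<rparr>)"
      by (rule in_block_regs[OF conjunct1[OF s2]]) simp
    from in_block_untouch[OF this] show ?thesis
      using True len s2 by (simp add: s3_def cs)
  next
    case False
    then show ?thesis using s2 len by (simp add: s3_def cs)
  qed
  have r: "regs s 6 = t" "regs s 8 = k" "okr (regs s)" using s by (auto simp: in_block_def prepping_def)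
  have r2: "regs s2 6 = t" "regs s2 8 = Suc k" "okr (regs s2)" using s2 by (auto simp: in_block_def prepping_def)
  have "step w shrink_core s = s3"
  proof -
    have "step w (block [incr 8,
       If (Op Less (Reg 6) (Reg 8)) Skip (block [Assign 13 (Op Minus (Reg 6) (Reg 8)), untouch])]) s = s2"
      using r k t bounds(2,6) by (simp add: s2_def s1_def)
    moreover have "step w (If (Op Less (Reg 3) (Op Plus (Reg 6) (Reg 8))) Skip
       (block [Assign 13 (Op Minus (Op Plus (Reg 6) (Reg 8)) (Const 1)), untouch])) s2 = s3"
      using r2 k t bounds(2,6) by (simp add: s3_def)
    ultimately show ?thesis by (simp add: shrink_core_def)
  qed
  then show ?thesis using s3 by simp
qed

lemma core_subset: "core t k \<subseteq> {..<n}"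
  using ps_subset[of t] by (auto simp: core_def)

text \<open>Radius \<open>0\<close> has an empty window, so the first core is \<open>ps t\<close>
  itself. Each round completes its block before the core shrinks to the next radius.\<close>

lemma wp_fill_time:
  assumes s: "prepping t (t * (T + 1)) s" "regs s 8 = 0" "\<forall>v<n. AR s 4 v = of_bool (v \<in> ps t)" and t: "t \<le> T"
  shows "wp w fill_time ((T + 2) * (block_time n + 10)) (prepping t ((t + 1) * (T + 1))) s"
  unfolding fill_time_def
proof (rule wp_While[where I = "\<lambda>s. prepping t (t * (T + 1) + regs s 8) s \<and> regs s 8 \<le> T + 1 \<and>
      (\<forall>v<n. AR s 4 v = of_bool (v \<in> core t (regs s 8)))"
    and \<mu> = "\<lambda>s. T + 1 - regs s 8" and tb = "block_time n"])
  fix s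
  let ?I = "\<lambda>s. prepping t (t * (T + 1) + regs s 8) s \<and> regs s 8 \<le> T + 1 \<and>
      (\<forall>v<n. AR s 4 v = of_bool (v \<in> core t (regs s 8)))"
  let ?b = "Op Less (Reg 8) (Op Plus (Reg 3) (Const 1))"
  have evb: "eval w ?b s = of_bool (regs s 8 < T + 1)" if "?I s"
    using that bounds(2,6) by (simp add: prepping_def)
  {
    assume I: "?I s" and "eval w ?b s = 0"
    then have "regs s 8 = T + 1" unfolding evb[OF I] by simp
    moreover have "(t + 1) * (T + 1) = t * (T + 1) + (T + 1)" by simp
    ultimately show "prepping t ((t + 1) * (T + 1)) s" using I by metis
  }
  assume I: "?I s" and ev: "eval w ?b s \<noteq> 0"
  define k where "k = regs s 8"
  define q where "q = t * (T + 1) + k"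
  have k: "k \<le> T" using ev unfolding evb[OF I] by (simp add: k_def)
  have q: "q < (T + 1) * (T + 1)" unfolding q_def by (rule block_less[OF t k])
  have r: "okr (regs s)" "regs s 6 = t" using I by (auto simp: prepping_def)
  let ?s1 = "s\<lparr>regs := (regs s)(9 := q * nn, 11 := 0)\<rparr>"
  have st: "step w (block [Assign 9 block_start, Assign 11 (Const 0)]) s = ?s1"
    using ev_block_start[OF r k_def[symmetric] t k] by (simp add: q_def)
  have s1: "in_block t k q (core t k) ?s1"
    using I unfolding in_block_def prepping_def by (simp add: k_def q_def)
  have last: "wp w shrink_core 200 (\<lambda>s'. ?I s' \<and> T + 1 - regs s' 8 < T + 1 - regs s 8) s'"
    if s': "in_block t k q (core t k) s' \<and> (\<forall>i<nn. cell s' q i = of_bool (via E (core t k) (i div n) (i mod n)))" for s'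
  proof -
    have "tab_ok (AR s' 6) q"
      using s' unfolding tab_ok_def q_def div_mod_block[OF k] by simp
    then have tab: "\<forall>q'<Suc q. tab_ok (AR s' 6) q'"
      using s' unfolding in_block_def prepping_def by (auto simp: less_Suc_eq)
    define s4 where "s4 = step w shrink_core s'"
    have b4: "in_block t (Suc k) q (core t (Suc k)) s4 \<and> AR s4 6 = AR s' 6"
      unfolding s4_def by (rule in_block_shrink_core) (use s' t k in auto)
    then have "?I s4 \<and> T + 1 - regs s4 8 < T + 1 - regs s 8"
      using b4 tab k unfolding in_block_def prepping_def by (simp add: k_def[symmetric] q_def)
    then show ?thesis
      by (intro wp_stepI[OF shrink_core_code s4_def[symmetric]])
  qed
  have "wp w (Seq init_block (Seq (Assign 10 (Const 0)) (Seq warshall shrink_core))) (block_time n - 50)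
    (\<lambda>s'. ?I s' \<and> T + 1 - regs s' 8 < T + 1 - regs s 8) ?s1"
  proof (rule wp_Seq_conseq[OF wp_init_block[OF s1 _ q], where ?t2.0 = "(n + 1) * (200 * (nn + 1) + 100) + 220"])
    fix s2
    assume s2: "in_block t k q (core t k) s2 \<and> (\<forall>i<nn. cell s2 q i = of_bool (via E {} (i div n) (i mod n)))"
    let ?s3 = "s2\<lparr>regs := (regs s2)(10 := 0)\<rparr>"
    have s3: "in_block t k q (core t k) ?s3" by (rule in_block_regs) (use s2 in auto)
    have "wp w warshall ((n + 1) * (200 * (nn + 1) + 100)) (\<lambda>s. in_block t k q (core t k) s \<and>
       (\<forall>i<nn. cell s q i = of_bool (via E (core t k) (i div n) (i mod n)))) ?s3"
      by (rule wp_warshall[OF s3 _ q core_subset]) (use s2 in auto)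
    then have "wp w (Seq warshall shrink_core) ((n + 1) * (200 * (nn + 1) + 100) + 200)
       (\<lambda>s'. ?I s' \<and> T + 1 - regs s' 8 < T + 1 - regs s 8) ?s3"
      by (rule wp_Seq_conseq[OF _ last]) auto
    then show "wp w (Seq (Assign 10 (Const 0)) (Seq warshall shrink_core)) ((n + 1) * (200 * (nn + 1) + 100) + 220)
       (\<lambda>s'. ?I s' \<and> T + 1 - regs s' 8 < T + 1 - regs s 8) s2"
      by - (rule wp_Seq_step[where ?t2.0 = "(n + 1) * (200 * (nn + 1) + 100) + 200"], simp_all)
  qed (simp_all add: block_time_def)
  then show "wp w (Seq (block [Assign 9 block_start, Assign 11 (Const 0)])
     (Seq init_block (Seq (Assign 10 (Const 0)) (Seq warshall shrink_core)))) (block_time n)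
     (\<lambda>s'. ?I s' \<and> T + 1 - regs s' 8 < T + 1 - regs s 8) s"
    unfolding st[symmetric]
    by - (rule wp_Seq_step[where ?t2.0 = "block_time n - 50"], simp_all add: block_start_def block_time_def)
next
  show "prepping t (t * (T + 1) + regs s 8) s \<and> regs s 8 \<le> T + 1 \<and>
      (\<forall>v<n. AR s 4 v = of_bool (v \<in> core t (regs s 8)))"
    using s by (simp add: core_def touched_0)
qed (use s in \<open>simp add: algebra_simps\<close>)


lemma wp_copy_pred:
  assumes s: "prepping t q s" "regs s 11 = 0"
  shows "wp w copy_pred (100 * (n + 1)) (\<lambda>s. prepping t q s \<and> (\<forall>v<n. AR s 4 v = of_bool (v \<in> ps t))) s"
  unfolding copy_pred_def
proof (rule wp_While[where I = "\<lambda>s. prepping t q s \<and> regs s 11 \<le> n \<and> (\<forall>v<regs s 11. AR s 4 v = of_bool (v \<in> ps t))"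
    and \<mu> = "\<lambda>s. n - regs s 11" and tb = 50])
  fix s
  let ?I = "\<lambda>s. prepping t q s \<and> regs s 11 \<le> n \<and> (\<forall>v<regs s 11. AR s 4 v = of_bool (v \<in> ps t))"
  let ?c = "block [put 4 (Reg 11) (arr 3 (Reg 11)), incr 11]"
  {
    assume I: "?I s" and "eval w (Op Less (Reg 11) (Reg 2)) s = 0"
    then show "prepping t q s \<and> (\<forall>v<n. AR s 4 v = of_bool (v \<in> ps t))" by (auto simp: prepping_def)
  }
  assume I: "?I s" and ev: "eval w (Op Less (Reg 11) (Reg 2)) s \<noteq> 0"
  define i where "i = regs s 11"
  have r: "okr (regs s)" "i < n" "AR s 3 i = of_bool (i \<in> ps t)"
    using I ev by (auto simp: prepping_def i_def)
  let ?s' = "s\<lparr>mem := (mem s)(adr L 4 i := of_bool (i \<in> ps t)), regs := (regs s)(11 := Suc i)\<rparr>"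
  have st: "step w ?c s = ?s'"
    using r bounds(1,6) unfolding i_def by simp
  have "prepping t q ?s'"
    using I unfolding prepping_def by simp
  then have Q: "?I ?s' \<and> n - regs ?s' 11 < n - regs s 11"
    using I r(2) by (auto simp: less_Suc_eq i_def)
  show "wp w ?c 50 (\<lambda>s'. ?I s' \<and> n - regs s' 11 < n - regs s 11) s"
    by (rule wp_stepI[OF _ _ st]; (rule Q)?) (simp_all add: code_defs)
qed (use s in \<open>auto\<close>)

text \<open>The last round of the table is at time \<open>T\<close>, where no predicted request
  remains to be applied.\<close>

lemma ps_stable: "T \<le> t \<Longrightarrow> ps (Suc t) = ps t"
  using len by (simp add: ps_def)

lemma advance_pred_code: "loopfree advance_pred" "ctime advance_pred \<le> 100"
  by (simp_all add: code_defs)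

lemma prepping_advance_pred:
  assumes s: "prepping t q s" and t: "t \<le> T"
  shows "prepping (Suc t) q (step w advance_pred s)"
proof -
  note s' = s[unfolded prepping_def]
  define s1 where "s1 = (if t < T \<and> ty t < 2 then s\<lparr>mem := (mem s)(adr L 3 (vx t) := 1 - AR s 3 (vx t))\<rparr> else s)"
  have st: "step w advance_pred s = s1\<lparr>regs := (regs s1)(6 := Suc t)\<rparr>"
    using s' t bounds(1,2,6) vx_less[of t]
    by (cases "t < T \<and> ty t < 2") (auto simp: advance_pred_def s1_def)
  have a3: "\<forall>v<n. AR s1 3 v = of_bool (v \<in> ps (Suc t))"
  proof (cases "t < T")
    case True
    then show ?thesis using s' vx_less[of t] by (simp add: s1_def ps_Suc toggle_def)
  next
    case False
    then show ?thesis using s' ps_stable[of t] by (simp add: s1_def)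
  qed
  show ?thesis
    unfolding st prepping_def using s' a3 by (simp add: s1_def)
qed

lemma wp_fill_table:
  assumes s: "prepping 0 0 s"
  shows "wp w fill_table ((T + 2) * (step_time n T + 10)) (\<lambda>s. \<exists>t. prepping t ((T + 1) * (T + 1)) s) s"
  unfolding fill_table_def
proof (rule wp_While[where I = "\<lambda>s. prepping (regs s 6) (regs s 6 * (T + 1)) s \<and> regs s 6 \<le> T + 1"
    and \<mu> = "\<lambda>s. T + 1 - regs s 6" and tb = "step_time n T"])
  fix s
  let ?I = "\<lambda>s. prepping (regs s 6) (regs s 6 * (T + 1)) s \<and> regs s 6 \<le> T + 1"
  let ?b = "Op Less (Reg 6) (Op Plus (Reg 3) (Const 1))"
  have evb: "eval w ?b s = of_bool (regs s 6 < T + 1)" if "?I s"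
    using that bounds(2,6) by (simp add: prepping_def)
  {
    assume I: "?I s" and "eval w ?b s = 0"
    then have "regs s 6 = T + 1" unfolding evb[OF I] by simp
    then show "\<exists>t. prepping t ((T + 1) * (T + 1)) s" using I by metis
  }
  assume I: "?I s" and ev: "eval w ?b s \<noteq> 0"
  define t where "t = regs s 6"
  have t: "t \<le> T" using ev unfolding evb[OF I] by (simp add: t_def)
  let ?Q = "\<lambda>s'. ?I s' \<and> T + 1 - regs s' 6 < T + 1 - regs s 6"
  have p4: "wp w advance_pred 100 ?Q s4" if "prepping t ((t + 1) * (T + 1)) s4" for s4
  proof -
    have "prepping (Suc t) ((t + 1) * (T + 1)) (step w advance_pred s4)"
      by (rule prepping_advance_pred[OF that t])
    moreover from this have "regs (step w advance_pred s4) 6 = Suc t" by (simp add: prepping_def)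
    ultimately have "?Q (step w advance_pred s4)" using t by (simp add: t_def[symmetric])
    then show ?thesis by (intro wp_step[OF advance_pred_code])
  qed
  have p3: "wp w (Seq (Assign 8 (Const 0)) (Seq fill_time advance_pred)) ((T + 2) * (block_time n + 10) + 150) ?Q s2"
    if s2: "prepping t (t * (T + 1)) s2 \<and> (\<forall>v<n. AR s2 4 v = of_bool (v \<in> ps t))" for s2
  proof -
    let ?s3 = "s2\<lparr>regs := (regs s2)(8 := 0)\<rparr>"
    have "wp w fill_time ((T + 2) * (block_time n + 10)) (prepping t ((t + 1) * (T + 1))) ?s3"
      by (rule wp_fill_time[OF _ _ _ t]) (use s2 in \<open>auto simp: prepping_def\<close>)
    then have "wp w (Seq fill_time advance_pred) ((T + 2) * (block_time n + 10) + 100) ?Q ?s3"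
      by (rule wp_Seq_conseq[OF _ p4]) auto
    then show ?thesis
      by - (rule wp_Seq_step[where ?t2.0 = "(T + 2) * (block_time n + 10) + 100"], simp_all)
  qed
  let ?s1 = "s\<lparr>regs := (regs s)(11 := 0)\<rparr>"
  have "prepping t (t * (T + 1)) ?s1" using I by (simp add: prepping_def t_def)
  then have "wp w copy_pred (100 * (n + 1)) (\<lambda>s. prepping t (t * (T + 1)) s \<and> (\<forall>v<n. AR s 4 v = of_bool (v \<in> ps t))) ?s1"
    by (rule wp_copy_pred) simp
  then have "wp w (Seq copy_pred (Seq (Assign 8 (Const 0)) (Seq fill_time advance_pred)))
      (100 * (n + 1) + ((T + 2) * (block_time n + 10) + 150)) ?Q ?s1"
    by (rule wp_Seq_conseq[OF _ p3]) auto
  then show "wp w (Seq (Assign 11 (Const 0)) (Seq copy_pred (Seq (Assign 8 (Const 0)) (Seq fill_time advance_pred))))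
     (step_time n T) ?Q s"
    by - (rule wp_Seq_step[where ?t2.0 = "100 * (n + 1) + ((T + 2) * (block_time n + 10) + 150)"],
        simp_all add: step_time_def)
next
  have r: "regs s 6 = 0" using s by (simp add: prepping_def)
  show "prepping (regs s 6) (regs s 6 * (T + 1)) s \<and> regs s 6 \<le> T + 1"
    unfolding r using s by simp
  show "(T + 1 - regs s 6 + 1) * (step_time n T + exp_time (Op Less (Reg 6) (Op Plus (Reg 3) (Const 1))) + 1)
    \<le> (T + 2) * (step_time n T + 10)"
    unfolding r by (simp add: algebra_simps)
qed

lemma wp_copy_input:
  assumes s: "okr (regs s)" "okm (mem s)" "regs s 6 = 0" "regs s 7 = 0" "regs s 11 = 0" "AR s 1 = (\<lambda>_. 0)" "AR s 2 = (\<lambda>_. 0)"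
  shows "wp w copy_input (100 * (n + 1)) (prepping 0 0) s"
  unfolding copy_input_def
proof (rule wp_While[where I = "\<lambda>s. okr (regs s) \<and> okm (mem s) \<and> regs s 6 = 0 \<and> regs s 7 = 0 \<and> regs s 11 \<le> n \<and>
      AR s 1 = (\<lambda>_. 0) \<and> AR s 2 = (\<lambda>_. 0) \<and>
      (\<forall>v<regs s 11. AR s 0 v = of_bool (v \<in> S0) \<and> AR s 3 v = of_bool (v \<in> S0))"
    and \<mu> = "\<lambda>s. n - regs s 11" and tb = 80])
  fix s
  let ?I = "\<lambda>s. okr (regs s) \<and> okm (mem s) \<and> regs s 6 = 0 \<and> regs s 7 = 0 \<and> regs s 11 \<le> n \<and>
      AR s 1 = (\<lambda>_. 0) \<and> AR s 2 = (\<lambda>_. 0) \<and>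
      (\<forall>v<regs s 11. AR s 0 v = of_bool (v \<in> S0) \<and> AR s 3 v = of_bool (v \<in> S0))"
  let ?c = "block [
     put 0 (Reg 11) (Mem (Op Plus (Op Times (Reg 2) (Reg 2)) (Reg 11))),
     put 3 (Reg 11) (Mem (Op Plus (Op Times (Reg 2) (Reg 2)) (Reg 11))),
     incr 11]"
  {
    assume I: "?I s" and "eval w (Op Less (Reg 11) (Reg 2)) s = 0"
    then show "prepping 0 0 s" by (simp add: prepping_def ps_0)
  }
  assume I: "?I s" and ev: "eval w (Op Less (Reg 11) (Reg 2)) s \<noteq> 0"
  define i where "i = regs s 11"
  have r: "okr (regs s)" "i < n" "okm (mem s)"
    using I ev by (auto simp: i_def)
  define s1 where "s1 = s\<lparr>mem := (mem s)(adr L 0 i := of_bool (i \<in> S0))\<rparr>"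
  let ?s' = "s1\<lparr>mem := (mem s1)(adr L 3 i := of_bool (i \<in> S0)), regs := (regs s)(11 := Suc i)\<rparr>"
  \<comment> \<open>The input cell is read a second time after a write to array 0; the input being
    intact, the same value is found.\<close>
  have "okm (mem s1)" using r by (simp add: s1_def)
  then have m: "mem s (nn + i) = of_bool (i \<in> S0)" "mem s1 (nn + i) = of_bool (i \<in> S0)"
    using r unfolding okm_def by auto
  have e: "eval w (Mem (Op Plus (Op Times (Reg 2) (Reg 2)) (Reg 11))) s = of_bool (i \<in> S0)"
    "eval w (Mem (Op Plus (Op Times (Reg 2) (Reg 2)) (Reg 11))) s1 = of_bool (i \<in> S0)"
    using r m bounds(4,5,6,7) by (simp_all add: i_def s1_def)
  have "step w (put 0 (Reg 11) (Mem (Op Plus (Op Times (Reg 2) (Reg 2)) (Reg 11)))) s = s1"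
    using r bounds(1) e by (simp add: s1_def i_def del: eval.simps(3))
  moreover have "step w (block [put 3 (Reg 11) (Mem (Op Plus (Op Times (Reg 2) (Reg 2)) (Reg 11))), incr 11]) s1 = ?s'"
    using r bounds(1,6) e by (simp add: i_def[symmetric] s1_def del: eval.simps(3))
  ultimately have st: "step w ?c s = ?s'" by simp
  have Q: "?I ?s' \<and> n - regs ?s' 11 < n - regs s 11"
    using I r(2) by (auto simp: less_Suc_eq i_def s1_def)
  show "wp w ?c 80 (\<lambda>s'. ?I s' \<and> n - regs s' 11 < n - regs s 11) s"
    by (rule wp_stepI[OF _ _ st]; (rule Q)?) (simp_all add: code_defs)
qed (use s in \<open>auto\<close>)

lemma wp_preprocess:
  assumes s: "regs s = (\<lambda>r. if r = 0 then n else if r = 1 then T else 0)" "okm (mem s)"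
    "AR s 1 = (\<lambda>_. 0)" "AR s 2 = (\<lambda>_. 0)"
  shows "wp w preprocess (prep_time n T) (serving 0 0 S0) s"
proof -
  let ?c0 = "block [Assign 2 (Reg 0), Assign 3 (Reg 1),
       Assign 5 (Op Plus (Op Times (Reg 2) (Reg 2)) (Reg 2)),
       Assign 4 (Op Plus (Reg 5) (Op Times (Const 3) (Reg 3)))]"
  let ?s1 = "s\<lparr>regs := (regs s)(2 := n, 3 := T, 5 := nn + n, 4 := L)\<rparr>"
  have st: "step w ?c0 s = ?s1"
    using s bounds L by simp
  have last: "wp w (Assign 6 (Const 0)) 10 (serving 0 0 S0) s2"
    if "\<exists>t. prepping t ((T + 1) * (T + 1)) s2" for s2
  proof -
    \<comment> \<open>At time \<open>0\<close> both sets are \<open>S0\<close>, which is what the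
      zeroed difference array and counter represent.\<close>
    have "diff 0 S0 = {}" by (simp add: diff_def ps_0)
    then show ?thesis
      using that S0 by (intro wp_step) (auto simp: prepping_def serving_def)
  qed
  have fill: "wp w (Seq fill_table (Assign 6 (Const 0))) ((T + 2) * (step_time n T + 10) + 10) (serving 0 0 S0) s2"
    if "prepping 0 0 s2" for s2
    by (rule wp_Seq_conseq[OF wp_fill_table[OF that] last]) auto
  have "wp w copy_input (100 * (n + 1)) (prepping 0 0) ?s1"
    by (rule wp_copy_input) (use s in \<open>auto simp: okr_def\<close>)
  then have "wp w (Seq copy_input (Seq fill_table (Assign 6 (Const 0))))
    (100 * (n + 1) + ((T + 2) * (step_time n T + 10) + 10)) (serving 0 0 S0) ?s1"
    by (rule wp_Seq_conseq[OF _ fill]) auto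
  then show ?thesis
    unfolding preprocess_def st[symmetric]
    by - (rule wp_Seq_step[where ?t2.0 = "100 * (n + 1) + ((T + 2) * (step_time n T + 10) + 10)"], simp_all add: prep_time_def)
qed

subsection \<open>Serving the requests\<close>

lemma update_code: "loopfree update" "ctime update \<le> 400"
  by (simp_all add: code_defs)

lemma serving_mono: "serving t b S s \<Longrightarrow> b \<le> b' \<Longrightarrow> serving t b' S s"
  unfolding serving_def by (meson order_trans)

lemma serving_pass:
  assumes "serving t b S s" "u < n" "v < n"
  shows "serving t b S (pass1 w u s)" "regs (pass1 w u s) 0 = u"
    "serving t b S (pass2 w u v s)" "regs (pass2 w u v s) 0 = u" "regs (pass2 w u v s) 1 = v"
proof -
  have "u < 2 ^ w" "v < 2 ^ w" using assms bounds(1,6) unfolding W by linarith+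
  then show "serving t b S (pass1 w u s)" "regs (pass1 w u s) 0 = u"
    "serving t b S (pass2 w u v s)" "regs (pass2 w u v s) 0 = u" "regs (pass2 w u v s) 1 = v"
    using assms(1) unfolding serving_def pass1_def pass2_def by auto
qed

text \<open>Equal numbers of updates have equal parity, so outside the window both toggled sets
  agree. This is the only link between the delay and the algorithm.\<close>

lemma diff_subset_touched:
  assumes "delayed d \<rho> rs" "length \<rho> = T" "t \<le> T"
  shows "diff t (set_after S0 (take t \<rho>)) \<subseteq> touched rs t d"
proof (rule subsetI, rule ccontr)
  fix v assume v: "v \<in> diff t (set_after S0 (take t \<rho>))" "v \<notin> touched rs t d"
  then have "hits v (take t \<rho>) = hits v (take t rs)"
    using hits_take_delayed[OF assms(1)] assms(2,3) by simp
  then show False using v(1) by (auto simp: diff_def ps_def set_after_def)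
qed

text \<open>Induction over the remaining requests, with the processed prefix \<open>\<rho>1\<close>
  recorded: the delay compares prefixes of the entire sequences, so the whole of
  \<open>\<rho>\<close> must stay in view.\<close>

lemma serves_algorithm:
  assumes \<rho>: "delayed d \<rho> rs" "length \<rho> = T"
    and "\<rho> = \<rho>1 @ \<rho>2" "S = set_after S0 \<rho>1" "valid_requests n S \<rho>2" "serving (length \<rho>1) (length \<rho>1) S s"
  shows "serves w algorithm G 400 (6000 * (d + 1) * (d + 1)) S s \<rho>2"
  using assms(3-)
proof (induction \<rho>2 arbitrary: \<rho>1 S s)
  case Nil
  then show ?case by simp
next
  case (Cons r \<rho>2)
  let ?t = "length \<rho>1"
  have t: "?t < T" using Cons.prems(1) \<rho>(2) by auto
  have split: "\<rho> = (\<rho>1 @ [r]) @ \<rho>2" using Cons.prems by simp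
  have update: "\<exists>t s'. exec w update (pass1 w v s) t s' \<and> t \<le> 400 \<and>
      serves w algorithm G 400 (6000 * (d + 1) * (d + 1)) S' s' \<rho>2"
    if "targets r = {v}" "v < n" "S' = toggle v S" "valid_requests n S' \<rho>2" for v S'
  proof -
    have "serving (Suc ?t) ?t S' (step w update (pass1 w v s))"
      using serving_update[OF serving_pass(1)[OF Cons.prems(4)] t] serving_pass(2)[OF Cons.prems(4)] that by simp
    \<comment> \<open>An update sets no stamps; the bound is merely raised to the new time.\<close>
    then have "serving (length (\<rho>1 @ [r])) (length (\<rho>1 @ [r])) S' (step w update (pass1 w v s))"
      by (auto elim: serving_mono)
    moreover have "S' = set_after S0 (\<rho>1 @ [r])"
      using that Cons.prems(2) by (auto simp: set_after_snoc toggle_def)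
    ultimately have "serves w algorithm G 400 (6000 * (d + 1) * (d + 1)) S' (step w update (pass1 w v s)) \<rho>2"
      using Cons.IH[OF split] that by blast
    then show ?thesis
      using exec_step[OF update_code(1)] update_code(2) by (meson order_trans)
  qed
  show ?case
  proof (cases r)
    case (Insert v)
    then have "insert v S = toggle v S" using Cons.prems(3) by (auto simp: toggle_def)
    then show ?thesis
      using update[of v "insert v S"] Cons.prems(3) Insert by (simp add: algorithm_def)
  next
    case (Remove v)
    then have "S - {v} = toggle v S" using Cons.prems(3) by (auto simp: toggle_def)
    then show ?thesis
      using update[of v "S - {v}"] Cons.prems(3) Remove by (simp add: algorithm_def)
  next
    case (Query u v)
    then have uv: "u < n" "v < n" "valid_requests n S \<rho>2" using Cons.prems(3) by auto
    \<comment> \<open>The scan needs a radius of at most \<open>T\<close>; the resulting time bound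
      is weakened to \<open>d\<close> afterwards.\<close>
    let ?d = "min d T"
    have sub: "diff ?t S \<subseteq> touched rs ?t ?d"
      using diff_subset_touched[OF delayed_min_length[OF \<rho>(1)], of ?t] \<rho>(2) t Cons.prems(1,2) by simp
    have "wp w query (6000 * (?d + 1) * (?d + 1))
      (\<lambda>s. serving (Suc ?t) (Suc ?t) S s \<and> regs s 0 = of_bool (connected_in G S u v)) (pass2 w u v s)"
      using serving_query[OF serving_pass(3)[OF Cons.prems(4) uv(1,2)] _ _ uv(1,2) t _ sub]
        serving_pass(4,5)[OF Cons.prems(4) uv(1,2)] by simp
    then obtain t' s' where s': "exec w query (pass2 w u v s) t' s'" "t' \<le> 6000 * (?d + 1) * (?d + 1)"
      "serving (Suc ?t) (Suc ?t) S s'" "regs s' 0 = of_bool (connected_in G S u v)"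
      unfolding wp_def by blast
    have "6000 * (?d + 1) * (?d + 1) \<le> 6000 * (d + 1) * (d + 1)"
      by (intro mult_le_mono) auto
    moreover have "S = set_after S0 (\<rho>1 @ [r])"
      using Query Cons.prems(2) by (simp add: set_after_snoc)
    then have "serves w algorithm G 400 (6000 * (d + 1) * (d + 1)) S s' \<rho>2"
      by (rule Cons.IH[OF split _ uv(3)]) (use s' in simp)
    ultimately show ?thesis
      using s'(1,2,4) Query by (auto simp: algorithm_def of_bool_def intro!: exI[of _ t'] exI[of _ s'])
  qed
qed

end

section \<open>The input\<close>

lemma nth_concat_uniform:
  assumes "\<And>i. i < m \<Longrightarrow> length (f i) = k" "i < m" "j < k"
  shows "concat (map f [0..<m]) ! (i * k + j) = f i ! j"
  using assms
proof (induction m)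
  case 0
  then show ?case by simp
next
  case (Suc m)
  have len: "length (concat (map f [0..<m])) = m * k"
    using Suc.prems(1) by (simp add: length_concat comp_def interv_sum_list_conv_sum_set_nat)
  show ?case
  proof (cases "i = m")
    case True
    then show ?thesis using len Suc.prems(3) by (simp add: nth_append)
  next
    case False
    then have i: "i < m" using Suc.prems(2) by simp
    have "i * k + j < i * k + k" using Suc.prems(3) by simp
    also have "\<dots> = Suc i * k" by simp
    also have "\<dots> \<le> m * k" using i by (intro mult_right_mono) auto
    finally show ?thesis using len i Suc by (simp add: nth_append)
  qed
qed

lemma length_concat_uniform:
  "(\<And>i. i < m \<Longrightarrow> length (f i) = k) \<Longrightarrow> length (concat (map f [0..<m])) = m * k"
  by (simp add: length_concat comp_def interv_sum_list_conv_sum_set_nat)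

lemma length_encode_request [simp]: "length (encode_request r) = 3"
  by (cases r) auto

lemma concat_encode: "concat (map encode_request rs) = concat (map (\<lambda>p. encode_request (rs ! p)) [0..<length rs])"
  by (metis (no_types, lifting) map_nth map_map comp_def map_cong)

lemma input_words_nth:
  fixes n :: nat and G S0 rs
  defines "xs \<equiv> input_words n G S0 rs"
  shows "length xs = n * n + n + 3 * length rs"
    "\<And>i. i < n * n \<Longrightarrow> xs ! i = of_bool ((i div n, i mod n) \<in> parcs G)"
    "\<And>v. v < n \<Longrightarrow> xs ! (n * n + v) = of_bool (v \<in> S0)"
    "\<And>p j. p < length rs \<Longrightarrow> j < 3 \<Longrightarrow> xs ! (n * n + n + 3 * p + j) = encode_request (rs ! p) ! j"
proof -
  let ?row = "\<lambda>u. map (\<lambda>v. if (u, v) \<in> parcs G then 1 else 0 :: nat) [0..<n]"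
  let ?A = "concat (map ?row [0..<n])"
  let ?B = "map (\<lambda>v. if v \<in> S0 then 1 else 0 :: nat) [0..<n]"
  let ?C = "concat (map (\<lambda>p. encode_request (rs ! p)) [0..<length rs])"
  have xs: "xs = ?A @ ?B @ ?C"
    unfolding xs_def input_words_def concat_encode[of rs] by simp
  have A: "length ?A = n * n" by (rule length_concat_uniform) simp
  have C: "length ?C = length rs * 3" by (rule length_concat_uniform) simp
  show "length xs = n * n + n + 3 * length rs" unfolding xs by (simp only: length_append A C) simp
  show "xs ! i = of_bool ((i div n, i mod n) \<in> parcs G)" if "i < n * n" for i
  proof -
    have dm: "i div n < n" "i mod n < n" using that by (auto simp: less_mult_imp_div_less intro!: mod_less_divisor gr0I)
    have "?A ! (i div n * n + i mod n) = ?row (i div n) ! (i mod n)"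
      by (rule nth_concat_uniform) (use dm in auto)
    then show ?thesis
      unfolding xs using that dm A by (simp add: nth_append)
  qed
  show "xs ! (n * n + v) = of_bool (v \<in> S0)" if "v < n" for v
    unfolding xs using that A by (simp add: nth_append)
  show "xs ! (n * n + n + 3 * p + j) = encode_request (rs ! p) ! j" if "p < length rs" "j < 3" for p j
  proof -
    have "?C ! (p * 3 + j) = encode_request (rs ! p) ! j"
      by (rule nth_concat_uniform) (use that in auto)
    then show ?thesis
      unfolding xs using A by (simp add: nth_append algebra_simps)
  qed
qed

section \<open>Polynomial bounds\<close>

text \<open>A bound for every \<open>n\<close>, not just eventually, is required to fix one word
  length factor for all inputs. Base \<open>n + 2\<close> is at least 2, so extra exponents absorb
  the constant factor and the finitely many exceptions.\<close>

lemma poly_bounded_iff: "poly_bounded f \<longleftrightarrow> (\<exists>a. \<forall>n. f n \<le> (n + 2) ^ a)"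
proof
  assume "poly_bounded f"
  then obtain k where "(\<lambda>n. real (f n)) \<in> O(\<lambda>n. real n ^ k)" unfolding poly_bounded_def by blast
  then obtain C where C: "eventually (\<lambda>n. norm (real (f n)) \<le> C * norm (real n ^ k)) at_top"
    by (elim landau_o.bigE)
  then obtain N where N: "\<And>n. n \<ge> N \<Longrightarrow> real (f n) \<le> C * real n ^ k"
    by (auto simp: eventually_at_top_linorder)
  \<comment> \<open>\<open>D\<close> rounds up the asymptotic constant and \<open>B\<close>
    dominates every value before the threshold; both become exponents by
    \<open>m \<le> (n + 2) ^ m\<close>.\<close>
  define D where "D = nat \<lceil>C\<rceil>"
  define B where "B = (\<Sum>n<N. f n)"
  have pow: "m \<le> (n + 2) ^ m" for m n :: nat
  proof -
    have "m \<le> 2 ^ m" using less_exp[of m] by simp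
    also have "\<dots> \<le> (n + 2) ^ m" by (intro power_mono) auto
    finally show ?thesis .
  qed
  have "f n \<le> (n + 2) ^ (k + D + B)" for n
  proof (cases "n < N")
    case True
    then have "f n \<le> B" unfolding B_def by (intro member_le_sum) auto
    also have "\<dots> \<le> (n + 2) ^ B" by (rule pow)
    also have "\<dots> \<le> (n + 2) ^ (k + D + B)" by (intro power_increasing) auto
    finally show ?thesis .
  next
    case False
    then have "real (f n) \<le> C * real n ^ k" by (intro N) simp
    also have "\<dots> \<le> real D * real n ^ k" unfolding D_def by (intro mult_right_mono) (auto simp: of_nat_ceiling)
    finally have "f n \<le> D * n ^ k" by (metis of_nat_le_iff of_nat_mult of_nat_power)
    also have "\<dots> \<le> (n + 2) ^ D * (n + 2) ^ k" by (intro mult_le_mono pow power_mono) auto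
    also have "\<dots> = (n + 2) ^ (k + D)" by (simp add: power_add)
    also have "\<dots> \<le> (n + 2) ^ (k + D + B)" by (intro power_increasing) auto
    finally show ?thesis .
  qed
  then show "\<exists>a. \<forall>n. f n \<le> (n + 2) ^ a" by blast
next
  assume "\<exists>a. \<forall>n. f n \<le> (n + 2) ^ a"
  then obtain a where a: "\<And>n. f n \<le> (n + 2) ^ a" by blast
  have "norm (real (f n)) \<le> 2 ^ a * norm (real n ^ a)" if "n \<ge> 2" for n
  proof -
    have "f n \<le> (2 * n) ^ a" using a[of n] power_mono[of "n + 2" "2 * n" a] that by simp
    then have "real (f n) \<le> real ((2 * n) ^ a)" by (simp only: of_nat_le_iff)
    then show ?thesis by (simp add: power_mult_distrib)
  qed
  then have "(\<lambda>n. real (f n)) \<in> O(\<lambda>n. real n ^ a)"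
    by (intro bigoI[of _ "2 ^ a"]) (auto simp: eventually_at_top_linorder)
  then show "poly_bounded f" unfolding poly_bounded_def by blast
qed

lemma poly_bounded_const: "poly_bounded (\<lambda>_. c)"
  unfolding poly_bounded_def by (intro exI[of _ 0]) simp

lemma poly_bounded_id: "poly_bounded (\<lambda>n. n)"
  unfolding poly_bounded_iff by (intro exI[of _ 1]) simp

lemma poly_bounded_mult:
  assumes "poly_bounded f" "poly_bounded g"
  shows "poly_bounded (\<lambda>n. f n * g n)"
proof -
  obtain a b where "\<And>n. f n \<le> (n + 2) ^ a" "\<And>n. g n \<le> (n + 2) ^ b"
    using assms unfolding poly_bounded_iff by blast
  then have "f n * g n \<le> (n + 2) ^ (a + b)" for n
    unfolding power_add by (intro mult_le_mono)
  then show ?thesis unfolding poly_bounded_iff by blast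
qed

lemma poly_bounded_add:
  assumes "poly_bounded f" "poly_bounded g"
  shows "poly_bounded (\<lambda>n. f n + g n)"
proof -
  obtain a b where ab: "\<And>n. f n \<le> (n + 2) ^ a" "\<And>n. g n \<le> (n + 2) ^ b"
    using assms unfolding poly_bounded_iff by blast
  have "f n + g n \<le> (n + 2) ^ (a + b + 1)" for n
  proof -
    have "(n + 2) ^ a \<le> (n + 2) ^ (a + b)" "(n + 2) ^ b \<le> (n + 2) ^ (a + b)"
      by (intro power_increasing; simp)+
    then have "f n + g n \<le> 2 * (n + 2) ^ (a + b)" using ab[of n] by linarith
    also have "\<dots> \<le> (n + 2) * (n + 2) ^ (a + b)" by (intro mult_right_mono) auto
    finally show ?thesis by simp
  qed
  then show ?thesis unfolding poly_bounded_iff by blast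
qed

lemmas poly_bounded_intros = poly_bounded_add poly_bounded_mult poly_bounded_const poly_bounded_id

theorem theorem8p17:
  fixes T :: "nat \<Rightarrow> nat"
  assumes "poly_bounded T"
  shows "\<exists>(A :: dyn_alg) (c :: nat) (P :: nat \<Rightarrow> nat) (U :: nat \<Rightarrow> nat) (Q :: nat \<Rightarrow> nat).
    poly_bounded P \<and> polylog_bounded U \<and> (\<lambda>d. real (Q d)) \<in> O(\<lambda>d. real d ^ 2) \<and>
    (\<forall>n w G S\<^sub>0 \<rho>' \<rho> d.
       real c * log 2 (real n + 2) \<le> real w \<longrightarrow>
       graph_on n G \<longrightarrow> S\<^sub>0 \<subseteq> {..<n} \<longrightarrow>
       length \<rho> = T n \<longrightarrow> valid_requests n S\<^sub>0 \<rho> \<longrightarrow> delayed d \<rho> \<rho>' \<longrightarrow>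
       solves w A n G S\<^sub>0 \<rho>' \<rho> (P n) (U n) (Q d))"
proof -
  define L where "L n = n * n + n + 3 * T n" for n
  define M where "M n = (T n + 1) * (T n + 1) * (n * n + 1) + n + 2 * T n + 8" for n
  \<comment> \<open>This quantity bounds all addresses, so the exponent of its polynomial bound is
    the word length factor \<open>c\<close>.\<close>
  have "poly_bounded (\<lambda>n. L n + 8 * M n + 8)"
    unfolding L_def M_def by (intro poly_bounded_intros assms)
  then obtain c where c: "\<And>n. L n + 8 * M n + 8 \<le> (n + 2) ^ c"
    unfolding poly_bounded_iff by blast
  have P: "poly_bounded (\<lambda>n. prep_time n (T n))"
    unfolding prep_time_def step_time_def block_time_def by (intro poly_bounded_intros assms)
  have U: "polylog_bounded (\<lambda>_. 400)"
    unfolding polylog_bounded_def by (intro exI[of _ 0]) simp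
  have Q: "(\<lambda>d. real (6000 * (d + 1) * (d + 1))) \<in> O(\<lambda>d. real d ^ 2)"
  \<comment> \<open>For \<open>d \<ge> 1\<close>, \<open>d + 1 \<le> 2 * d\<close> costs a factor 4
    on 6000.\<close>
  proof (intro bigoI[of _ 24000])
    have "real (6000 * (d + 1) * (d + 1)) \<le> 24000 * real d ^ 2" if "d \<ge> 1" for d
    proof -
      have "(d + 1) * (d + 1) \<le> (2 * d) * (2 * d)" using that by (intro mult_le_mono) auto
      then have "6000 * (d + 1) * (d + 1) \<le> 24000 * d ^ 2" by (simp add: power2_eq_square algebra_simps)
      then have "real (6000 * (d + 1) * (d + 1)) \<le> real (24000 * d ^ 2)" by (simp only: of_nat_le_iff)
      then show ?thesis by simp
    qed
    then show "\<forall>\<^sub>F d in at_top. norm (real (6000 * (d + 1) * (d + 1))) \<le> 24000 * norm (real d ^ 2)"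
      by (auto simp: eventually_at_top_linorder intro!: exI[of _ 1] simp del: of_nat_mult of_nat_add)
  qed
  have "solves w algorithm n G S0 \<rho>' \<rho> (prep_time n (T n)) 400 (6000 * (d + 1) * (d + 1))"
    if w: "real c * log 2 (real n + 2) \<le> real w" and S0: "S0 \<subseteq> {..<n}"
      and \<rho>: "length \<rho> = T n" "valid_requests n S0 \<rho>" "delayed d \<rho> \<rho>'" for n w G S0 \<rho>' \<rho> d
  proof -
    \<comment> \<open>Exponentiating the word length assumption yields
      \<open>(n + 2) ^ c \<le> 2 ^ w\<close>.\<close>
    have "2 powr (real c * log 2 (real n + 2)) = (2 powr log 2 (real n + 2)) powr real c"
      by (simp only: powr_powr mult.commute)
    also have "\<dots> = (real n + 2) ^ c" by (simp add: powr_realpow)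
    finally have "(real n + 2) ^ c = 2 powr (real c * log 2 (real n + 2))" ..
    also have "\<dots> \<le> 2 powr real w" using w by (intro powr_mono) auto
    also have "\<dots> = 2 ^ w" by (simp add: powr_realpow)
    finally have "real ((n + 2) ^ c) \<le> real (2 ^ w)" by (simp add: add.commute)
    then have "(n + 2) ^ c \<le> 2 ^ w" by (simp only: of_nat_le_iff)
    with c[of n] have fits: "L n + 8 * M n + 8 \<le> 2 ^ w" by linarith
    \<comment> \<open>Vertex bounds come from validity of the actual sequence and pass to the
      prediction because both contain the same requests; the prediction itself may fail to be
      valid.\<close>
    have "targets r \<subseteq> {..<n}" if "valid_requests n S rs" "r \<in> set rs" for r rs S
      using that by (induction n S rs rule: valid_requests.induct) auto
    then have targets: "targets r \<subseteq> {..<n}" if "r \<in> set \<rho>'" for r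
      using \<rho> that delayed_set by blast
    interpret subgraph_instance w n "T n" "2 ^ w" "L n" "M n" G S0 \<rho>'
      by unfold_locales (use fits S0 targets \<rho>(1) delayed_length[OF \<rho>(3)] in \<open>auto simp: L_def M_def\<close>)
    let ?s = "init_state w n G S0 \<rho>'"
    note inp = input_words_nth[where n = n and G = G and ?S0.0 = S0 and rs = \<rho>', unfolded len]
    have small: "n < 2 ^ w" "T n < 2 ^ w" "2 < (2::nat) ^ w" using bounds(1,2,6) by linarith+
    have low: "mem ?s a = input_words n G S0 \<rho>' ! a mod 2 ^ w" if "a < L n" for a
      using that inp(1) by (simp add: init_state_def Let_def L_def)
    have high: "mem ?s a = 0" if "a \<ge> L n" for a
      using that inp(1) by (simp add: init_state_def Let_def L_def)
    have "okm (mem ?s)"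
      unfolding okm_def
    proof (intro conjI allI impI)
      fix i assume i: "i < n * n"
      then show "mem ?s i = of_bool ((i div n, i mod n) \<in> parcs G)"
        using low[of i] inp(2)[OF i] small by (simp add: L_def)
    next
      fix v assume v: "v < n"
      then show "mem ?s (n * n + v) = of_bool (v \<in> S0)"
        using low[of "n * n + v"] inp(3)[OF v] small by (simp add: L_def)
    next
      fix p assume p: "p < T n"
      have enc: "ty p < 2 ^ w" "vx p < 2 ^ w"
      proof -
        have r: "\<rho>' ! p \<in> set \<rho>" using p len delayed_set[OF \<rho>(3)] nth_mem by metis
        have "encode_request r ! 0 \<le> 2 \<and> encode_request r ! 1 < n" if "valid_requests n S rs" "r \<in> set rs" for r rs S
          using that by (induction n S rs rule: valid_requests.induct) auto
        from this[OF \<rho>(2) r] show "ty p < 2 ^ w" "vx p < 2 ^ w"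
          using small by (auto simp: ty_def vx_def)
      qed
      show "mem ?s (n * n + n + 3 * p) = ty p"
        using low[of "n * n + n + 3 * p"] inp(4)[OF p, of 0] p enc by (simp add: L_def ty_def)
      show "mem ?s (n * n + n + 3 * p + 1) = vx p"
        using low[of "n * n + n + 3 * p + 1"] inp(4)[OF p, of 1] p enc by (simp add: L_def vx_def)
    qed
    moreover have "AR ?s r = (\<lambda>_. 0)" for r
      using high by (auto simp: ar_def adr_def)
    moreover have "regs ?s = (\<lambda>r. if r = 0 then n else if r = 1 then T n else 0)"
      using small len by (auto simp: init_state_def)
    ultimately have "wp w preprocess (prep_time n (T n)) (serving 0 0 S0) ?s"
      by (intro wp_preprocess)
    then obtain t s where "exec w preprocess ?s t s" "t \<le> prep_time n (T n)" "serving 0 0 S0 s"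
      unfolding wp_def by blast
    moreover from this(3) have "serves w algorithm G 400 (6000 * (d + 1) * (d + 1)) S0 s \<rho>"
      by (intro serves_algorithm[OF \<rho>(3,1), of "[]"]) (use \<rho> in \<open>simp_all add: set_after_Nil\<close>)
    ultimately show ?thesis
      unfolding solves_def by (auto simp: algorithm_def)
  qed
  with P U Q show ?thesis
    by (intro exI[of _ algorithm] exI[of _ c] exI[of _ "\<lambda>n. prep_time n (T n)"] exI[of _ "\<lambda>_. 400"]
        exI[of _ "\<lambda>d. 6000 * (d + 1) * (d + 1)"]) blast
qed

end
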